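(* Let $u,v\in\mathcal{H}_m^p(\mathbb{C}^n)$ be given by their Almansi expansions $$u(x)=\sum_{j=0}^{p-1}u_j(x)|x|^{2j},\quad u_j(x)=\sum_{|\alpha|=m-2j}a_{j,\alpha}x^\alpha\in\mathcal{H}_{m-2j}(\mathbb{C}^n),$$ $$v(x)=\sum_{j=0}^{p-1}v_j(x)|x|^{2j},\quad v_j(x)=\sum_{|\alpha|=m-2j}b_{j,\alpha}x^\alpha\in\mathcal{H}_{m-2j}(\mathbb{C}^n).$$ Then $$\langle u,v\rangle_{\widehat S_p}=\sum_{j=0}^{p-1}\sum_{|\alpha|=m-2j}a_{j,\alpha}\overline{b_{j,\alpha}}\,\frac{\alpha!}{n(n+2)\cdots(n+2m-2(2j+1))}$$ and $$\langle u,v\rangle_F=\sum_{j,k=0}^{p-1}\ \sum_{|\beta|=j}\ \sum_{|\tilde\beta|=k}\ \sum_{\substack{|\alpha|=m-2j\\ |\tilde\alpha|=m-2k\\ \alpha+2\beta=\tilde\alpha+2\tilde\beta}}(\alpha+2\beta)!\,\frac{j!}{\beta!}\,\frac{k!}{\tilde\beta!}\,a_{j,\alpha}\overline{b_{k,\tilde\alpha}}.$$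
   Context: Here $n\ge2$, $p\ge1$, and $\alpha,\tilde\alpha,\beta,\tilde\beta$ range over multi-indices in $\mathbb{N}_0^n$. $\mathcal{H}_m^p(\mathbb{C}^n)$ is the space of homogeneous polynomials $q$ of degree $m$ on $\mathbb{C}^n$ with $\Delta^pq=0$ ($\Delta=\sum_j\partial^2/\partial z_j^2$), and $\mathcal{H}_m(\mathbb{C}^n)=\mathcal{H}_m^1(\mathbb{C}^n)$ is the space of harmonic ones. $|x|^2=\sum_jx_j^2$. Sums over $|\alpha|=m-2j$ with $m-2j<0$ are empty (then $u_j=v_j=0$). The product $n(n+2)\cdots(n+2m-2(2j+1))$ is $\prod_{i=0}^{m-2j-1}(n+2i)$ (equal to $1$ if $m=2j$). The integral inner product is $$\langle f,g\rangle_{\widehat S_p}=\frac1p\int_S\sum_{j=0}^{p-1}f(e^{j\pi i/p}\zeta)\overline{g(e^{j\pi i/p}\zeta)}\,d\sigma(\zeta),$$ where $S$ is the unit sphere in $\mathbb{R}^n$, $\sigma$ is its normalized surface measure, and $\widehat S_p=\bigcup_{l=0}^{p-1}e^{l\pi i/p}S$. The Fischer inner product of $P=\sum_\alpha c_\alpha x^\alpha$ and $Q=\sum_\alpha d_\alpha x^\alpha$ is $\langle P,Q\rangle_F=\sum_\alpha\alpha!\,c_\alpha\overline{d_\alpha}$. *)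

theory Defs
  imports "HOL-Analysis.Analysis"
begin

section \<open>Multi-indices and polynomial functions\<close>

definition mdeg :: "nat ^ 'n::finite \<Rightarrow> nat" where
  "mdeg \<alpha> = (\<Sum>i\<in>UNIV. \<alpha> $ i)"

definition mfact :: "nat ^ 'n::finite \<Rightarrow> nat" where
  "mfact \<alpha> = (\<Prod>i\<in>UNIV. fact (\<alpha> $ i))"

definition mpow :: "complex ^ 'n::finite \<Rightarrow> nat ^ 'n \<Rightarrow> complex" where
  "mpow x \<alpha> = (\<Prod>i\<in>UNIV. (x $ i) ^ (\<alpha> $ i))"

lemma finite_mdeg_le: "finite {\<alpha> :: nat ^ 'n::finite. mdeg \<alpha> \<le> k}"
proof -
  have "\<alpha> $ i \<le> k" if "mdeg \<alpha> \<le> k" for \<alpha> :: "nat ^ 'n" and i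
    using that member_le_sum[of i UNIV "\<lambda>i. \<alpha> $ i"] by (auto simp: mdeg_def)
  hence "{\<alpha> :: nat ^ 'n. mdeg \<alpha> \<le> k} \<subseteq> vec_lambda ` (Pi\<^sub>E UNIV (\<lambda>_. {..k}))"
    by (auto intro!: image_eqI[where x = "vec_nth _"] simp: vec_lambda_eta)
  thus ?thesis
    by (rule finite_subset) (intro finite_imageI finite_PiE, auto)
qed

lemma finite_mdeg_eq: "finite {\<alpha> :: nat ^ 'n::finite. mdeg \<alpha> = k}"
  by (rule finite_subset[OF _ finite_mdeg_le[of k]]) auto

text \<open>
  A polynomial on complex \<open>n\<close>-space is treated as a function. Its coefficient family is
  unique, which is shown below, so that \<open>THE\<close> is well behaved on polynomial functions.
\<close>

definition has_mcoeffs :: "(complex ^ 'n::finite \<Rightarrow> complex) \<Rightarrow> (nat ^ 'n \<Rightarrow> complex) \<Rightarrow> bool" where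
  "has_mcoeffs P c \<longleftrightarrow> finite {\<alpha>. c \<alpha> \<noteq> 0} \<and> (\<forall>x. P x = (\<Sum>\<alpha> | c \<alpha> \<noteq> 0. c \<alpha> * mpow x \<alpha>))"

definition mcoeff :: "(complex ^ 'n::finite \<Rightarrow> complex) \<Rightarrow> nat ^ 'n \<Rightarrow> complex" where
  "mcoeff P = (THE c. has_mcoeffs P c)"

lemma monomials_independent_aux:
  fixes e :: "nat ^ 'n::finite \<Rightarrow> complex" and I :: "'n set"
  assumes "finite I" "finite A"
    and "\<And>\<alpha> \<beta>. \<alpha> \<in> A \<Longrightarrow> \<beta> \<in> A \<Longrightarrow> (\<And>i. i \<in> I \<Longrightarrow> \<alpha> $ i = \<beta> $ i) \<Longrightarrow> \<alpha> = \<beta>"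
    and "\<And>x :: 'n \<Rightarrow> complex. (\<Sum>\<alpha>\<in>A. e \<alpha> * (\<Prod>i\<in>I. x i ^ (\<alpha> $ i))) = 0"
    and "\<gamma> \<in> A"
  shows "e \<gamma> = 0"
  using assms
proof (induction I arbitrary: A rule: finite_induct)
  case empty
  have "A = {\<gamma>}" using empty.prems(2,4) by auto
  thus ?case using empty.prems(3)[of "\<lambda>_. 0"] by simp
next
  case (insert k J)
  define N where "N = Max ((\<lambda>\<alpha>. \<alpha> $ k) ` A)"
  have N: "\<alpha> $ k \<le> N" if "\<alpha> \<in> A" for \<alpha>
    using that insert.prems(1) by (auto simp: N_def)
  define B where "B = {\<alpha>\<in>A. \<alpha> $ k = \<gamma> $ k}"
  have "(\<Sum>\<alpha>\<in>B. e \<alpha> * (\<Prod>i\<in>J. x i ^ (\<alpha> $ i))) = 0" for x :: "'n \<Rightarrow> complex"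
  proof -
    define s where "s d = (\<Sum>\<alpha> | \<alpha> \<in> A \<and> \<alpha> $ k = d. e \<alpha> * (\<Prod>i\<in>J. x i ^ (\<alpha> $ i)))" for d
    have "(\<Sum>d\<le>N. s d * t ^ d) = 0" for t
    proof -
      have "0 = (\<Sum>\<alpha>\<in>A. e \<alpha> * (\<Prod>i\<in>insert k J. (x(k := t)) i ^ (\<alpha> $ i)))"
        by (rule insert.prems(3)[symmetric])
      also have "\<dots> = (\<Sum>\<alpha>\<in>A. e \<alpha> * (\<Prod>i\<in>J. x i ^ (\<alpha> $ i)) * t ^ (\<alpha> $ k))"
      proof (intro sum.cong refl)
        fix \<alpha>
        have "(\<Prod>i\<in>J. (x(k := t)) i ^ (\<alpha> $ i)) = (\<Prod>i\<in>J. x i ^ (\<alpha> $ i))"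
          using insert.hyps by (intro prod.cong) auto
        thus "e \<alpha> * (\<Prod>i\<in>insert k J. (x(k := t)) i ^ (\<alpha> $ i)) =
              e \<alpha> * (\<Prod>i\<in>J. x i ^ (\<alpha> $ i)) * t ^ (\<alpha> $ k)"
          using insert.hyps by (simp add: mult_ac)
      qed
      also have "\<dots> = (\<Sum>d\<le>N. \<Sum>\<alpha> | \<alpha> \<in> A \<and> \<alpha> $ k = d.
                          e \<alpha> * (\<Prod>i\<in>J. x i ^ (\<alpha> $ i)) * t ^ (\<alpha> $ k))"
        using N insert.prems(1) by (intro sum.group[symmetric]) auto
      also have "\<dots> = (\<Sum>d\<le>N. s d * t ^ d)"
        unfolding s_def sum_distrib_right by (intro sum.cong) auto
      finally show ?thesis by simp
    qed
    hence "\<forall>d\<le>N. s d = 0" using polyfun_eq_0[of s N] by blast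
    hence "s (\<gamma> $ k) = 0" using N insert.prems(4) by blast
    thus ?thesis unfolding s_def B_def .
  qed
  moreover have "finite B" "\<gamma> \<in> B" using insert.prems by (auto simp: B_def)
  moreover have "\<alpha> = \<beta>" if "\<alpha> \<in> B" "\<beta> \<in> B" "\<And>i. i \<in> J \<Longrightarrow> \<alpha> $ i = \<beta> $ i" for \<alpha> \<beta>
    using that by (intro insert.prems(2)) (auto simp: B_def)
  ultimately show ?case using insert.IH[of B] by blast
qed

lemma has_mcoeffs_unique:
  assumes "has_mcoeffs P c" "has_mcoeffs P d"
  shows "c = d"
proof
  fix \<gamma>
  define A where "A = insert \<gamma> ({\<alpha>. c \<alpha> \<noteq> 0} \<union> {\<alpha>. d \<alpha> \<noteq> 0})"
  have fin: "finite A" using assms by (auto simp: A_def has_mcoeffs_def)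
  have c: "P x = (\<Sum>\<alpha>\<in>A. c \<alpha> * mpow x \<alpha>)" for x
    using assms(1) fin unfolding has_mcoeffs_def
    by (simp, intro sum.mono_neutral_left) (auto simp: A_def)
  have d: "P x = (\<Sum>\<alpha>\<in>A. d \<alpha> * mpow x \<alpha>)" for x
    using assms(2) fin unfolding has_mcoeffs_def
    by (simp, intro sum.mono_neutral_left) (auto simp: A_def)
  have "c \<gamma> - d \<gamma> = 0"
  proof (rule monomials_independent_aux[where I = UNIV and A = A and e = "\<lambda>\<alpha>. c \<alpha> - d \<alpha>"])
    fix x :: "'a \<Rightarrow> complex"
    show "(\<Sum>\<alpha>\<in>A. (c \<alpha> - d \<alpha>) * (\<Prod>i\<in>UNIV. x i ^ (\<alpha> $ i))) = 0"
      using c[of "vec_lambda x"] d[of "vec_lambda x"]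
      by (simp add: mpow_def left_diff_distrib sum_subtractf)
  qed (use fin in \<open>auto simp: A_def vec_eq_iff\<close>)
  thus "c \<gamma> = d \<gamma>" by simp
qed

lemma mcoeff_eqI: "has_mcoeffs P c \<Longrightarrow> mcoeff P = c"
  unfolding mcoeff_def using has_mcoeffs_unique by blast

definition fischer_inner ::
    "(complex ^ 'n::finite \<Rightarrow> complex) \<Rightarrow> (complex ^ 'n \<Rightarrow> complex) \<Rightarrow> complex" where
  "fischer_inner P Q =
     (\<Sum>\<alpha> | mcoeff P \<alpha> \<noteq> 0 \<and> mcoeff Q \<alpha> \<noteq> 0. of_nat (mfact \<alpha>) * mcoeff P \<alpha> * cnj (mcoeff Q \<alpha>))"


section \<open>Polyharmonic homogeneous polynomials\<close>

definition homogeneous_poly :: "nat \<Rightarrow> (complex ^ 'n::finite \<Rightarrow> complex) \<Rightarrow> bool" where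
  "homogeneous_poly m q \<longleftrightarrow> (\<exists>c. \<forall>x. q x = (\<Sum>\<alpha> | mdeg \<alpha> = m. c \<alpha> * mpow x \<alpha>))"

definition partial_deriv ::
    "'n \<Rightarrow> (complex ^ 'n::finite \<Rightarrow> complex) \<Rightarrow> complex ^ 'n \<Rightarrow> complex" where
  "partial_deriv j f z = deriv (\<lambda>t. f (z + axis j t)) 0"

definition laplacian :: "(complex ^ 'n::finite \<Rightarrow> complex) \<Rightarrow> complex ^ 'n \<Rightarrow> complex" where
  "laplacian f z = (\<Sum>j\<in>UNIV. partial_deriv j (partial_deriv j f) z)"

definition polyharmonic :: "nat \<Rightarrow> nat \<Rightarrow> (complex ^ 'n::finite \<Rightarrow> complex) set" where
  "polyharmonic p m = {q. homogeneous_poly m q \<and> (\<forall>z. (laplacian ^^ p) q z = 0)}"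

abbreviation harmonic :: "nat \<Rightarrow> (complex ^ 'n::finite \<Rightarrow> complex) set" where
  "harmonic m \<equiv> polyharmonic 1 m"

text \<open>The bilinear (not Hermitian) square \<open>|x|\<^sup>2\<close>, holomorphic in \<open>x\<close>.\<close>

definition csq :: "complex ^ 'n::finite \<Rightarrow> complex" where
  "csq x = (\<Sum>j\<in>UNIV. (x $ j)\<^sup>2)"


section \<open>Normalized surface measure and the integral inner product\<close>

text \<open>
  The surface measure of a subset \<open>A\<close> of the unit sphere is the dimension times the
  Lebesgue measure of the punctured unit cone over \<open>A\<close>.
\<close>

definition sphere_surface :: "'a::euclidean_space measure" where
  "sphere_surface =
     scale_measure (of_nat DIM('a)) (distr (restrict_space lborel (ball 0 1 - {0})) borel sgn)"

definition sphere_prob :: "'a::euclidean_space measure" where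
  "sphere_prob = uniform_measure sphere_surface (sphere 0 1)"

lemma borel_measurable_sgn_vector:
  "(sgn :: 'a::euclidean_space \<Rightarrow> 'a) \<in> borel_measurable borel"
  unfolding sgn_div_norm[abs_def] by measurable

lemma sets_sphere_surface [simp]: "sets sphere_surface = sets borel"
  by (simp add: sphere_surface_def)

lemma sets_sphere_prob [simp]: "sets sphere_prob = sets borel"
  by (simp add: sphere_prob_def)

lemma emeasure_sphere_surface:
  fixes A :: "'a::euclidean_space set"
  assumes "A \<in> sets borel"
  shows "emeasure sphere_surface A =
           of_nat DIM('a) * emeasure lborel {x \<in> ball 0 1 - {0}. x /\<^sub>R norm x \<in> A}"
proof -
  have "sgn \<in> restrict_space lborel (ball 0 1 - {0 :: 'a}) \<rightarrow>\<^sub>M borel"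
    by (intro measurable_restrict_space1) (simp add: borel_measurable_sgn_vector)
  moreover have "sgn -` A \<inter> space (restrict_space lborel (ball 0 1 - {0 :: 'a})) =
                 {x \<in> ball 0 1 - {0}. x /\<^sub>R norm x \<in> A}"
    by (auto simp: sgn_div_norm space_restrict_space)
  moreover have "emeasure (restrict_space lborel (ball 0 1 - {0 :: 'a}))
                   {x \<in> ball 0 1 - {0}. x /\<^sub>R norm x \<in> A} =
                 emeasure lborel {x \<in> ball 0 1 - {0}. x /\<^sub>R norm x \<in> A}"
    by (intro emeasure_restrict_space) auto
  ultimately show ?thesis using assms
    by (simp add: sphere_surface_def emeasure_distr)
qed

lemma emeasure_sphere_surface_sphere:
  "emeasure sphere_surface (sphere 0 1 :: 'a::euclidean_space set) =
     of_nat DIM('a) * ennreal (unit_ball_vol DIM('a))"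
proof -
  have "{x \<in> ball 0 1 - {0}. x /\<^sub>R norm x \<in> sphere 0 1} = ball 0 1 - {0 :: 'a}"
    by auto
  moreover have "emeasure lborel (ball 0 1 - {0 :: 'a}) = emeasure lborel (ball 0 1 :: 'a set)"
    by (rule emeasure_Diff_null_set) auto
  ultimately show ?thesis
    by (simp add: emeasure_sphere_surface emeasure_ball)
qed

lemma space_sphere_prob [simp]: "space sphere_prob = UNIV"
  using sets_eq_imp_space_eq[OF sets_sphere_prob] by simp

lemma emeasure_sphere_prob_sphere:
  "emeasure sphere_prob (sphere 0 1 :: 'a::euclidean_space set) = 1"
proof -
  have "unit_ball_vol (real DIM('a)) > 0" by simp
  thus ?thesis unfolding sphere_prob_def
    by (intro emeasure_uniform_measure_1)
       (simp_all add: emeasure_sphere_surface_sphere ennreal_mult_eq_top_iff del: unit_ball_vol_pos)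
qed

lemma emeasure_sphere_prob_space:
  "emeasure (sphere_prob :: 'a::euclidean_space measure) UNIV = 1"
proof -
  have "emeasure (sphere_prob :: 'a measure) UNIV = emeasure (sphere_prob :: 'a measure) (sphere 0 1)"
    unfolding sphere_prob_def by (subst (1 2) emeasure_uniform_measure) auto
  thus ?thesis by (simp add: emeasure_sphere_prob_sphere)
qed

definition cvec :: "real ^ 'n::finite \<Rightarrow> complex ^ 'n" where
  "cvec \<zeta> = (\<chi> i. complex_of_real (\<zeta> $ i))"

definition sphere_inner ::
    "nat \<Rightarrow> (complex ^ 'n::finite \<Rightarrow> complex) \<Rightarrow> (complex ^ 'n \<Rightarrow> complex) \<Rightarrow> complex" where
  "sphere_inner p f g =
     1 / of_nat p * (LINT \<zeta>:sphere 0 1|(sphere_prob :: (real ^ 'n) measure).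
        (\<Sum>j<p. f (exp (of_nat j * of_real pi * \<i> / of_nat p) *s cvec \<zeta>)
              * cnj (g (exp (of_nat j * of_real pi * \<i> / of_nat p) *s cvec \<zeta>))))"

end

theory Submission
  imports Defs
begin

text \<open>
  Write \<open>n\<close> for the dimension. On each of the \<open>p\<close> rotated spheres a form of degree \<open>m\<close> only picks
  up a unimodular factor, so the integral inner product of \<open>u\<close> and \<open>v\<close> is the mean of
  \<open>u cnj v\<close> over the real unit sphere. There \<open>|x|\<^sup>2 = 1\<close>, so \<open>u\<close> and \<open>v\<close> are the sums of their
  harmonic components. It remains to know the mean of a product of two harmonic forms: it is zero
  when the degrees differ, and for equal degree \<open>k\<close> it is their Fischer pairing divided by
  \<open>n (n + 2) \<dots> (n + 2k - 2)\<close>.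

  Both facts come from one identity for forms \<open>f\<close> of degree \<open>d\<close>
  (\<open>sphere_mean_laplacian\<close>): the mean of \<open>\<Delta>f\<close> is \<open>d (n + d - 2)\<close> times the mean of \<open>f\<close>. It
  follows from rotation invariance alone. The mean of a rotational derivative
  \<open>x\<^sub>i \<partial>\<^sub>j g - x\<^sub>j \<partial>\<^sub>i g\<close> vanishes (\<open>sphere_mean_angular_deriv\<close>), and by Euler's identity
  \<open>|x|\<^sup>2 \<Delta>f - d (n + d - 2) f\<close> is a sum of such derivatives (\<open>sum_angular_deriv\<close>).
  For harmonic \<open>f\<close> and \<open>g\<close> one has \<open>\<Delta>(f g) = 2 \<Sum>\<^sub>i (\<partial>\<^sub>i f) (\<partial>\<^sub>i g)\<close>, so the identity expresses the
  mean of \<open>f g\<close> by means for harmonic forms of degree one less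
  (\<open>sphere_mean_harmonic_mult\<close>), and the Fischer pairing obeys the matching recursion
  (\<open>fischer_form_derivatives\<close>). Induction on the degree gives
  \<open>sphere_mean_harmonic_orthogonal\<close> and \<open>sphere_mean_harmonic_eq_fischer\<close>.

  The formula for the Fischer inner product is the expansion of \<open>|x|\<^sup>2\<^sup>j\<close> by the multinomial
  theorem, after which like monomials are collected; since the coefficients of a polynomial are
  unique, they can be read off (\<open>fischer_inner_almansi\<close>).
\<close>

section \<open>Orthogonal invariance of the normalized surface measure\<close>

lemma nn_integral_lborel_reflect_translate:
  fixes f :: "'a::euclidean_space \<Rightarrow> ennreal"
  assumes [measurable]: "f \<in> borel_measurable borel" and "\<bar>c\<bar> = 1"
  shows "(\<integral>\<^sup>+x. f (t + c *\<^sub>R x) \<partial>lborel) = (\<integral>\<^sup>+x. f x \<partial>lborel)"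
proof -
  have "lborel = density (distr lborel borel (\<lambda>x. t + c *\<^sub>R x)) (\<lambda>_. 1)"
    using lborel_affine[of c t] assms by auto
  hence "lborel = distr lborel borel (\<lambda>x. t + c *\<^sub>R x)"
    by (simp add: density_1)
  hence "(\<integral>\<^sup>+x. f x \<partial>lborel) = (\<integral>\<^sup>+x. f x \<partial>distr lborel borel (\<lambda>x. t + c *\<^sub>R x))"
    by simp
  also have "\<dots> = (\<integral>\<^sup>+x. f (t + c *\<^sub>R x) \<partial>lborel)"
    by (rule nn_integral_distr) auto
  finally show ?thesis ..
qed

lemma borel_measurable_orthogonal_transformation:
  fixes R :: "'a::euclidean_space \<Rightarrow> 'a"
  assumes "orthogonal_transformation R"
  shows "R \<in> borel_measurable borel"
  using linear_continuous_on[of R UNIV] orthogonal_transformation_linear[OF assms]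
  by (intro borel_measurable_continuous_onI) (simp add: linear_conv_bounded_linear)

text \<open>
  Uniqueness of Haar measure in miniature. With \<open>B\<close> the unit ball, integrate
  \<open>1\<^sub>A(R x) 1\<^sub>B(y + R x)\<close> over \<open>x\<close> and \<open>y\<close>. Integrating over \<open>y\<close> first gives
  \<open>\<lambda>(R\<inverse>A) \<lambda>(B)\<close>. Substituting \<open>x - R\<inverse>y\<close> for \<open>x\<close> before integrating over \<open>y\<close> gives
  \<open>\<lambda>(A) \<lambda>(R\<inverse>B)\<close>, and \<open>R\<inverse>B = B\<close>, so the positive finite factor \<open>\<lambda>(B)\<close> cancels.
\<close>

lemma emeasure_lborel_orthogonal_vimage:
  fixes R :: "'a::euclidean_space \<Rightarrow> 'a"
  assumes R: "orthogonal_transformation R" and A: "A \<in> sets borel"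
  shows "emeasure lborel (R -` A) = emeasure lborel A"
proof -
  define B where "B = ball (0::'a) 1"
  have [measurable]: "B \<in> sets borel" by (simp add: B_def)
  have lin: "linear R" using R by (rule orthogonal_transformation_linear)
  have [measurable]: "R \<in> borel_measurable borel"
    using R by (rule borel_measurable_orthogonal_transformation)
  have [measurable]: "A \<in> sets borel" by (rule A)
  define S where "S = inv R"
  have RS: "R (S y) = y" for y
    using orthogonal_transformation_surj[OF R] by (simp add: S_def surj_f_inv_f)
  let ?f = "\<lambda>x y. indicator A (R x) * indicator B (y + R x) :: ennreal"
  have "emeasure lborel (R -` A) * emeasure lborel B
      = (\<integral>\<^sup>+x. indicator A (R x) * emeasure lborel B \<partial>lborel)"
    by (subst nn_integral_multc)
       (auto simp flip: indicator_vimage intro!: nn_integral_indicator[symmetric] arg_cong2[where f = "(*)"] measurable_sets_borel[of _ borel])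
  also have "\<dots> = (\<integral>\<^sup>+x. (\<integral>\<^sup>+y. ?f x y \<partial>lborel) \<partial>lborel)"
  proof (rule nn_integral_cong)
    fix x
    have "(\<integral>\<^sup>+y. indicator B (R x + 1 *\<^sub>R y) \<partial>lborel) = emeasure lborel B"
      by (subst nn_integral_lborel_reflect_translate[where f = "indicator B"])
         (auto intro!: borel_measurable_indicator)
    moreover have "(\<lambda>y. indicator B (y + R x) :: ennreal) \<in> borel_measurable borel"
      by (rule measurable_compose[of "\<lambda>y. y + R x" borel borel "indicator B"])
         (auto intro!: borel_measurable_indicator)
    ultimately show "indicator A (R x) * emeasure lborel B = (\<integral>\<^sup>+y. ?f x y \<partial>lborel)"
      by (simp add: nn_integral_cmult add.commute)
  qed
  also have "\<dots> = (\<integral>\<^sup>+y. (\<integral>\<^sup>+x. ?f x y \<partial>lborel) \<partial>lborel)"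
    by (rule lborel_pair.Fubini') measurable
  also have "\<dots> = (\<integral>\<^sup>+y. (\<integral>\<^sup>+x. indicator A (R x - y) * indicator B (R x) \<partial>lborel) \<partial>lborel)"
  proof (rule nn_integral_cong)
    fix y
    have "R (- S y + 1 *\<^sub>R x) = R x - y" for x
      using lin by (simp add: linear_diff linear_add linear_neg RS)
    thus "(\<integral>\<^sup>+x. ?f x y \<partial>lborel) = (\<integral>\<^sup>+x. indicator A (R x - y) * indicator B (R x) \<partial>lborel)"
      using nn_integral_lborel_reflect_translate[of "\<lambda>x. ?f x y" 1 "- S y"] by simp
  qed
  also have "\<dots> = (\<integral>\<^sup>+x. (\<integral>\<^sup>+y. indicator A (R x - y) * indicator B (R x) \<partial>lborel) \<partial>lborel)"
    by (rule lborel_pair.Fubini') measurable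
  also have "\<dots> = (\<integral>\<^sup>+x. emeasure lborel A * indicator B x \<partial>lborel)"
  proof (rule nn_integral_cong)
    fix x
    have "(\<integral>\<^sup>+y. indicator A (R x + (-1) *\<^sub>R y) \<partial>lborel) = emeasure lborel A"
      by (subst nn_integral_lborel_reflect_translate[where f = "indicator A"])
         (auto intro!: borel_measurable_indicator)
    moreover have "indicator B (R x) = (indicator B x :: ennreal)"
      using orthogonal_transformation_norm[OF R] by (auto simp: indicator_def B_def)
    ultimately show "(\<integral>\<^sup>+y. indicator A (R x - y) * indicator B (R x) \<partial>lborel)
        = emeasure lborel A * indicator B x"
      by (subst nn_integral_multc) auto
  qed
  also have "\<dots> = emeasure lborel A * emeasure lborel B"
    by (subst nn_integral_cmult) auto
  finally have "emeasure lborel B * emeasure lborel (R -` A) = emeasure lborel B * emeasure lborel A"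
    by (simp only: mult.commute)
  moreover have "emeasure lborel B = ennreal (unit_ball_vol DIM('a))" "unit_ball_vol (real DIM('a)) > 0"
    by (simp_all add: B_def emeasure_ball)
  ultimately show ?thesis
    by (auto simp: ennreal_mult_cancel_left)
qed

text \<open>
  The surface measure of a set is read off from the Lebesgue measure of a cone, and \<open>R\<close> maps
  the cone over \<open>R -` B\<close> onto the cone over \<open>B\<close>.
\<close>

lemma sphere_prob_orthogonal_invariant:
  fixes R :: "'a::euclidean_space \<Rightarrow> 'a"
  assumes R: "orthogonal_transformation R"
  shows "distr sphere_prob borel R = sphere_prob"
proof (rule measure_eqI)
  have lin: "linear R" using R by (rule orthogonal_transformation_linear)
  have meas [measurable]: "R \<in> borel_measurable borel"
    using R by (rule borel_measurable_orthogonal_transformation)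
  have surface: "emeasure sphere_surface (R -` B) = emeasure sphere_surface B"
    if B: "B \<in> sets borel" for B
  proof -
    let ?C = "{x \<in> ball 0 1 - {0}. x /\<^sub>R norm x \<in> B}"
    have "?C = (ball 0 1 - {0}) \<inter> sgn -` B"
      by (auto simp: sgn_div_norm)
    hence C: "?C \<in> sets borel"
      using measurable_sets_borel[OF borel_measurable_sgn_vector B] by auto
    have "{x \<in> ball 0 1 - {0}. x /\<^sub>R norm x \<in> R -` B} = R -` ?C"
      using orthogonal_transformation_norm[OF R] linear_cmul[OF lin] linear_0[OF lin]
      by (auto, metis norm_eq_zero)
    thus ?thesis
      using B emeasure_lborel_orthogonal_vimage[OF R C] measurable_sets_borel[OF meas B]
      by (simp only: emeasure_sphere_surface)
  qed
  fix A :: "'a set" assume "A \<in> sets (distr sphere_prob borel R)"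
  hence A: "A \<in> sets borel" by simp
  have RA: "R -` A \<in> sets borel" using measurable_sets_borel[OF meas A] .
  have "sphere 0 1 \<inter> R -` A = R -` (sphere 0 1 \<inter> A)"
    using orthogonal_transformation_norm[OF R] by auto
  hence "emeasure sphere_prob (R -` A) = emeasure sphere_prob A"
    using A RA surface[of "sphere 0 1 \<inter> A"] by (simp add: sphere_prob_def)
  thus "emeasure (distr sphere_prob borel R) A = emeasure sphere_prob A"
    using A by (subst emeasure_distr) (auto cong: measurable_cong_sets)
qed simp

section \<open>Homogeneous polynomial functions and their derivatives\<close>

text \<open>
  Homogeneous polynomials are generated as functions instead of being given by coefficients,
  so that the product rule, Euler's identity and the symmetry of second derivatives all follow
  by induction over sums and products. The zero function has every degree; this lets the
  derivative of a form of degree \<open>d\<close> have degree \<open>d - 1\<close> also when \<open>d = 0\<close>.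
\<close>

inductive hpolyfun :: "nat \<Rightarrow> (complex ^ 'n::finite \<Rightarrow> complex) \<Rightarrow> bool" where
  hpolyfun_const: "hpolyfun 0 (\<lambda>_. c)"
| hpolyfun_zero: "hpolyfun d (\<lambda>_. 0)"
| hpolyfun_coord: "hpolyfun 1 (\<lambda>x. x $ i)"
| hpolyfun_add: "hpolyfun d f \<Longrightarrow> hpolyfun d g \<Longrightarrow> hpolyfun d (\<lambda>x. f x + g x)"
| hpolyfun_mult: "hpolyfun d f \<Longrightarrow> hpolyfun e g \<Longrightarrow> hpolyfun (d + e) (\<lambda>x. f x * g x)"

lemma hpolyfun_sum:
  assumes "\<And>a. a \<in> A \<Longrightarrow> hpolyfun d (f a)"
  shows "hpolyfun d (\<lambda>x. \<Sum>a\<in>A. f a x)"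
  using assms
  by (induction A rule: infinite_finite_induct) (auto intro: hpolyfun_zero hpolyfun_add)

lemma hpolyfun_cmult: "hpolyfun d f \<Longrightarrow> hpolyfun d (\<lambda>x. c * f x)"
  using hpolyfun_mult[OF hpolyfun_const[of c]] by force

lemma hpolyfun_power: "hpolyfun d f \<Longrightarrow> hpolyfun (k * d) (\<lambda>x. f x ^ k)"
  by (induction k) (auto intro: hpolyfun_const hpolyfun_mult)

lemma hpolyfun_prod:
  assumes "\<And>a. a \<in> A \<Longrightarrow> hpolyfun (d a) (f a)"
  shows "hpolyfun (\<Sum>a\<in>A. d a) (\<lambda>x. \<Prod>a\<in>A. f a x)"
  using assms
  by (induction A rule: infinite_finite_induct) (auto intro: hpolyfun_const hpolyfun_mult)

lemma hpolyfun_mpow: "hpolyfun (mdeg \<alpha>) (\<lambda>x. mpow x \<alpha>)"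
proof -
  have "hpolyfun (\<Sum>i\<in>UNIV. \<alpha> $ i) (\<lambda>x. \<Prod>i\<in>UNIV. (x $ i) ^ (\<alpha> $ i))"
    by (intro hpolyfun_prod) (use hpolyfun_power[OF hpolyfun_coord] in force)
  thus ?thesis by (simp add: mdeg_def mpow_def)
qed

lemma hpolyfun_homogeneous: "hpolyfun d f \<Longrightarrow> f (t *s x) = t ^ d * f x"
  by (induction rule: hpolyfun.induct) (auto simp: algebra_simps power_add)

text \<open>
  A complex-linear total derivative determines the partial derivatives; this is what connects
  the one-variable limits in \<^const>\<open>partial_deriv\<close> with the chain rule and the product rule.
\<close>

lemma has_field_derivative_along_axis:
  fixes f :: "complex ^ 'n::finite \<Rightarrow> complex"
  assumes "(f has_derivative (\<lambda>h. \<Sum>j\<in>UNIV. h $ j * g j)) (at x)"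
  shows "((\<lambda>t. f (x + axis i t)) has_field_derivative g i) (at 0)"
proof -
  have "((\<lambda>t. x + axis i t) has_derivative (\<lambda>t. axis i t)) (at (0::complex))"
  proof -
    have "bounded_linear (\<lambda>t. axis i t :: complex ^ 'n)"
      by (simp add: linear_conv_bounded_linear[symmetric], rule linearI)
         (auto simp: vec_eq_iff axis_def)
    from has_derivative_add[OF has_derivative_const bounded_linear_imp_has_derivative[OF this]]
    show ?thesis by simp
  qed
  moreover have "x + axis i 0 = x" by (simp add: vec_eq_iff axis_def)
  ultimately have "((\<lambda>t. f (x + axis i t)) has_derivative
                     (\<lambda>t. \<Sum>j\<in>UNIV. axis i t $ j * g j)) (at 0)"
    using assms by (intro has_derivative_compose[of "\<lambda>t. x + axis i t" _ _ _ f]) (simp_all only:)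
  moreover have "(\<lambda>t. \<Sum>j\<in>UNIV. axis i t $ j * g j) = (\<lambda>t. g i * t)"
    by (auto simp: axis_def if_distrib if_distribR sum.If_cases cong: if_cong)
  ultimately show ?thesis
    by (simp add: has_field_derivative_def)
qed

lemma partial_deriv_eqI:
  fixes f :: "complex ^ 'n::finite \<Rightarrow> complex"
  assumes "(f has_derivative (\<lambda>h. \<Sum>j\<in>UNIV. h $ j * g j)) (at x)"
  shows "partial_deriv i f x = g i"
  unfolding partial_deriv_def
  by (rule DERIV_imp_deriv[OF has_field_derivative_along_axis[OF assms]])

lemma hpolyfun_has_derivative:
  fixes f :: "complex ^ 'n::finite \<Rightarrow> complex"
  assumes "hpolyfun d f"
  shows "(f has_derivative (\<lambda>h. \<Sum>i\<in>UNIV. h $ i * partial_deriv i f x)) (at x)"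
proof -
  have "\<exists>g. (f has_derivative (\<lambda>h. \<Sum>i\<in>UNIV. h $ i * g i)) (at x)"
    using assms
  proof (induction rule: hpolyfun.induct)
    case (hpolyfun_coord i)
    have "bounded_linear (\<lambda>x. x $ i :: complex)"
      by (rule bounded_linear_vec_nth)
    moreover have "(\<lambda>h :: complex ^ 'n. \<Sum>j\<in>UNIV. h $ j * (if j = i then 1 else 0)) = (\<lambda>h. h $ i)"
      by (simp add: if_distrib cong: if_cong)
    ultimately show ?case
      by (intro exI[of _ "\<lambda>j. if j = i then 1 else 0"])
         (simp add: bounded_linear_imp_has_derivative)
  next
    case (hpolyfun_add d f g)
    then obtain f' g' where
      "(f has_derivative (\<lambda>h. \<Sum>i\<in>UNIV. h $ i * f' i)) (at x)"
      "(g has_derivative (\<lambda>h. \<Sum>i\<in>UNIV. h $ i * g' i)) (at x)" by blast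
    from has_derivative_add[OF this] show ?case
      by (intro exI[of _ "\<lambda>i. f' i + g' i"]) (simp add: distrib_left sum.distrib)
  next
    case (hpolyfun_mult d f e g)
    then obtain f' g' where
      "(f has_derivative (\<lambda>h. \<Sum>i\<in>UNIV. h $ i * f' i)) (at x)"
      "(g has_derivative (\<lambda>h. \<Sum>i\<in>UNIV. h $ i * g' i)) (at x)" by blast
    from has_derivative_mult[OF this] show ?case
      by (intro exI[of _ "\<lambda>i. f x * g' i + f' i * g x"])
         (simp add: distrib_left sum.distrib sum_distrib_left sum_distrib_right mult_ac)
  qed (auto intro: exI[of _ "\<lambda>_. 0"])
  then obtain g where g: "(f has_derivative (\<lambda>h. \<Sum>i\<in>UNIV. h $ i * g i)) (at x)" ..
  moreover have "g = (\<lambda>i. partial_deriv i f x)"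
    using partial_deriv_eqI[OF g] by auto
  ultimately show ?thesis by simp
qed

lemma partial_deriv_const [simp]: "partial_deriv i (\<lambda>_. c) = (\<lambda>_. 0)"
  by (simp add: fun_eq_iff partial_deriv_def)

lemma partial_deriv_coord:
  "partial_deriv i (\<lambda>x :: complex ^ 'n::finite. x $ j) = (\<lambda>_. if i = j then 1 else 0)"
proof
  fix x :: "complex ^ 'n"
  have "((\<lambda>x. x $ j) has_derivative (\<lambda>h :: complex ^ 'n. h $ j)) (at x)"
    by (rule bounded_linear_imp_has_derivative) (rule bounded_linear_vec_nth)
  moreover have "(\<lambda>h :: complex ^ 'n. \<Sum>i\<in>UNIV. h $ i * (if i = j then 1 else 0)) = (\<lambda>h. h $ j)"
    by (simp add: if_distrib cong: if_cong)
  ultimately show "partial_deriv i (\<lambda>x. x $ j) x = (if i = j then 1 else 0)"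
    by (intro partial_deriv_eqI) simp
qed

lemma partial_deriv_add:
  assumes "hpolyfun d f" "hpolyfun e g"
  shows "partial_deriv i (\<lambda>x. f x + g x) = (\<lambda>x. partial_deriv i f x + partial_deriv i g x)"
proof
  fix x
  show "partial_deriv i (\<lambda>x. f x + g x) x = partial_deriv i f x + partial_deriv i g x"
    using has_derivative_add[OF assms[THEN hpolyfun_has_derivative, of x]]
    by (intro partial_deriv_eqI) (simp add: distrib_left sum.distrib)
qed

lemma partial_deriv_mult:
  assumes "hpolyfun d f" "hpolyfun e g"
  shows "partial_deriv i (\<lambda>x. f x * g x) =
           (\<lambda>x. partial_deriv i f x * g x + f x * partial_deriv i g x)"
proof
  fix x
  show "partial_deriv i (\<lambda>x. f x * g x) x = partial_deriv i f x * g x + f x * partial_deriv i g x"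
    using has_derivative_mult[OF assms[THEN hpolyfun_has_derivative, of x]]
    by (intro partial_deriv_eqI)
       (simp add: distrib_left sum.distrib sum_distrib_left sum_distrib_right mult_ac add.commute)
qed

lemma partial_deriv_sum:
  assumes "\<And>a. a \<in> A \<Longrightarrow> hpolyfun d (f a)"
  shows "partial_deriv i (\<lambda>x. \<Sum>a\<in>A. f a x) = (\<lambda>x. \<Sum>a\<in>A. partial_deriv i (f a) x)"
  using assms
proof (induction A rule: infinite_finite_induct)
  case (insert a A)
  thus ?case
    by (simp add: partial_deriv_add[of d _ d] hpolyfun_sum)
qed auto

text \<open>
  The vanishing for \<open>d = 0\<close> has to be carried along: in a product \<open>f g\<close> with \<open>d = 0\<close>, the
  term \<open>(\<partial>\<^sub>i f) g\<close> has the required degree \<open>e - 1\<close> only because it is zero.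
\<close>

lemma hpolyfun_partial_deriv_degree:
  assumes "hpolyfun d f"
  shows "hpolyfun (d - 1) (partial_deriv i f) \<and> (d = 0 \<longrightarrow> partial_deriv i f = (\<lambda>_. 0))"
  using assms
proof (induction rule: hpolyfun.induct)
  case (hpolyfun_add d f g)
  thus ?case by (auto simp: partial_deriv_add intro!: hpolyfun.intros)
next
  case (hpolyfun_mult d f e g)
  have "hpolyfun (d + e - 1) (\<lambda>x. partial_deriv i f x * g x)"
  proof (cases "d = 0")
    case False
    have "hpolyfun ((d - 1) + e) (\<lambda>x. partial_deriv i f x * g x)"
      using hpolyfun_mult by (intro hpolyfun.intros) auto
    thus ?thesis using False by simp
  qed (use hpolyfun_mult in \<open>auto intro: hpolyfun_zero\<close>)
  moreover have "hpolyfun (d + e - 1) (\<lambda>x. f x * partial_deriv i g x)"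
  proof (cases "e = 0")
    case False
    have "hpolyfun (d + (e - 1)) (\<lambda>x. f x * partial_deriv i g x)"
      using hpolyfun_mult by (intro hpolyfun.intros) auto
    thus ?thesis using False by simp
  qed (use hpolyfun_mult in \<open>auto intro: hpolyfun_zero\<close>)
  ultimately show ?case
    using hpolyfun_mult by (auto simp: partial_deriv_mult intro!: hpolyfun.hpolyfun_add)
qed (auto simp: partial_deriv_coord intro: hpolyfun.intros)

lemmas hpolyfun_partial_deriv = hpolyfun_partial_deriv_degree[THEN conjunct1]

lemma euler_identity:
  fixes f :: "complex ^ 'n::finite \<Rightarrow> complex"
  assumes "hpolyfun d f"
  shows "(\<Sum>i\<in>UNIV. x $ i * partial_deriv i f x) = of_nat d * f x"
  using assms
proof (induction rule: hpolyfun.induct)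
  case (hpolyfun_coord i)
  show ?case by (simp add: partial_deriv_coord if_distrib cong: if_cong)
next
  case (hpolyfun_add d f g)
  thus ?case by (simp add: partial_deriv_add distrib_left sum.distrib)
next
  case (hpolyfun_mult d f e g)
  have "(\<Sum>i\<in>UNIV. x $ i * partial_deriv i (\<lambda>x. f x * g x) x)
      = (\<Sum>i\<in>UNIV. x $ i * partial_deriv i f x) * g x + f x * (\<Sum>i\<in>UNIV. x $ i * partial_deriv i g x)"
    using hpolyfun_mult.hyps
    by (simp add: partial_deriv_mult distrib_left sum.distrib sum_distrib_left sum_distrib_right mult_ac)
  thus ?case using hpolyfun_mult.IH by (simp add: algebra_simps)
qed auto

lemma partial_deriv_commute:
  assumes "hpolyfun d f"
  shows "partial_deriv i (partial_deriv j f) = partial_deriv j (partial_deriv i f)"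
  using assms
proof (induction rule: hpolyfun.induct)
  case (hpolyfun_add d f g)
  note [simp] = partial_deriv_add[OF hpolyfun_add.hyps]
    partial_deriv_add[OF hpolyfun_add.hyps[THEN hpolyfun_partial_deriv]]
  show ?case using hpolyfun_add.IH by simp
next
  case (hpolyfun_mult d f e g)
  note pd = hpolyfun_mult.hyps[THEN hpolyfun_partial_deriv]
  have "partial_deriv k (partial_deriv l (\<lambda>x. f x * g x)) = (\<lambda>x.
          partial_deriv k (partial_deriv l f) x * g x + partial_deriv l f x * partial_deriv k g x
        + (partial_deriv k f x * partial_deriv l g x + f x * partial_deriv k (partial_deriv l g) x))" for k l
  proof -
    note [simp] = partial_deriv_mult[OF hpolyfun_mult.hyps]
      partial_deriv_mult[OF pd(1) hpolyfun_mult.hyps(2)]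
      partial_deriv_mult[OF hpolyfun_mult.hyps(1) pd(2)]
      partial_deriv_add[OF hpolyfun.hpolyfun_mult hpolyfun.hpolyfun_mult,
        OF pd(1) hpolyfun_mult.hyps(2) hpolyfun_mult.hyps(1) pd(2)]
    show ?thesis by simp
  qed
  thus ?case using hpolyfun_mult.IH by (simp add: add_ac)
qed (auto simp: partial_deriv_coord)

lemma laplacian_mult:
  assumes f: "hpolyfun d f" and g: "hpolyfun e g"
  shows "laplacian (\<lambda>x. f x * g x) x = laplacian f x * g x
     + 2 * (\<Sum>i\<in>UNIV. partial_deriv i f x * partial_deriv i g x) + f x * laplacian g x"
proof -
  note pd = f[THEN hpolyfun_partial_deriv] g[THEN hpolyfun_partial_deriv]
  have "partial_deriv i (partial_deriv i (\<lambda>x. f x * g x)) x =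
          partial_deriv i (partial_deriv i f) x * g x + 2 * (partial_deriv i f x * partial_deriv i g x)
        + f x * partial_deriv i (partial_deriv i g) x" for i
  proof -
    note [simp] = partial_deriv_mult[OF f g] partial_deriv_mult[OF pd(1) g] partial_deriv_mult[OF f pd(2)]
      partial_deriv_add[OF hpolyfun.hpolyfun_mult hpolyfun.hpolyfun_mult, OF pd(1) g f pd(2)]
    show ?thesis by simp
  qed
  thus ?thesis
    by (simp add: laplacian_def sum.distrib sum_distrib_left sum_distrib_right)
qed

lemma laplacian_partial_deriv_eq_0:
  assumes f: "hpolyfun d f" and "laplacian f = (\<lambda>_. 0)"
  shows "laplacian (partial_deriv i f) = (\<lambda>_. 0)"
proof -
  have "laplacian (partial_deriv i f) =
        (\<lambda>x. \<Sum>j\<in>UNIV. partial_deriv i (partial_deriv j (partial_deriv j f)) x)"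
    unfolding laplacian_def
    by (simp add: partial_deriv_commute[OF f, of _ i]
      partial_deriv_commute[OF hpolyfun_partial_deriv[OF f], of _ i])
  also have "\<dots> = partial_deriv i (laplacian f)"
    unfolding laplacian_def
    by (rule partial_deriv_sum[OF hpolyfun_partial_deriv[OF hpolyfun_partial_deriv[OF f]], symmetric])
  finally show ?thesis using assms(2) by simp
qed

section \<open>Spherical means\<close>

text \<open>
  The argument is a function on complex space because polynomials are differentiated in complex
  directions, although they are averaged over real points only.
\<close>

definition sphere_mean :: "(complex ^ 'n::finite \<Rightarrow> complex) \<Rightarrow> complex" where
  "sphere_mean f = (LINT \<zeta>:sphere 0 1|(sphere_prob :: (real ^ 'n) measure). f (cvec \<zeta>))"

lemma finite_measure_sphere_prob: "finite_measure (sphere_prob :: 'a::euclidean_space measure)"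
  by (rule finite_measureI) (simp add: emeasure_sphere_prob_space)

lemma bounded_linear_cvec: "bounded_linear (cvec :: real ^ 'n::finite \<Rightarrow> _)"
  unfolding linear_conv_bounded_linear[symmetric]
  by (rule linearI) (auto simp: cvec_def vec_eq_iff scaleR_conv_of_real[where 'a = complex])

lemma hpolyfun_continuous_on: "hpolyfun d f \<Longrightarrow> continuous_on S f"
  by (intro continuous_at_imp_continuous_on ballI has_derivative_continuous[OF hpolyfun_has_derivative])

lemma hpolyfun_cvec_measurable:
  "hpolyfun d f \<Longrightarrow> (\<lambda>\<zeta>. f (cvec \<zeta>)) \<in> borel_measurable borel"
  by (intro borel_measurable_continuous_onI
        continuous_on_compose2[OF hpolyfun_continuous_on[of d f UNIV]]
        linear_continuous_on bounded_linear_cvec) auto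

lemma hpolyfun_bounded_on_sphere:
  assumes "hpolyfun d f"
  obtains K where "\<And>\<zeta>. norm \<zeta> = 1 \<Longrightarrow> norm (f (cvec \<zeta>)) \<le> K"
proof -
  have "continuous_on (sphere 0 1) (\<lambda>\<zeta>. f (cvec \<zeta>))"
    by (intro continuous_on_compose2[OF hpolyfun_continuous_on[OF assms, of UNIV]]
        linear_continuous_on bounded_linear_cvec) auto
  hence "bounded ((\<lambda>\<zeta>. f (cvec \<zeta>)) ` sphere 0 1)"
    by (intro compact_imp_bounded compact_continuous_image) auto
  then obtain K where "\<forall>x\<in>(\<lambda>\<zeta>. f (cvec \<zeta>)) ` sphere 0 1. norm x \<le> K"
    unfolding bounded_iff by blast
  thus ?thesis by (intro that[of K]) auto
qed

lemma hpolyfun_set_integrable_sphere: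
  assumes "hpolyfun d f"
  shows "set_integrable sphere_prob (sphere 0 1) (\<lambda>\<zeta>. f (cvec \<zeta>))"
proof -
  obtain K where K: "\<And>\<zeta>. norm \<zeta> = 1 \<Longrightarrow> norm (f (cvec \<zeta>)) \<le> K"
    using hpolyfun_bounded_on_sphere[OF assms] by blast
  show ?thesis unfolding set_integrable_def
  proof (rule finite_measure.integrable_const_bound[OF finite_measure_sphere_prob, of _ "max 0 K"])
    show "AE \<zeta> in sphere_prob. norm (indicator (sphere 0 1) \<zeta> *\<^sub>R f (cvec \<zeta>)) \<le> max 0 K"
      using K by (intro AE_I2) (auto simp: indicator_def max.coboundedI2)
    have "(\<lambda>\<zeta>. indicator (sphere 0 1) \<zeta> *\<^sub>R f (cvec \<zeta>)) \<in> borel_measurable borel"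
      by (intro borel_measurable_scaleR borel_measurable_indicator hpolyfun_cvec_measurable[OF assms])
         simp
    thus "(\<lambda>\<zeta>. indicator (sphere 0 1) \<zeta> *\<^sub>R f (cvec \<zeta>)) \<in> borel_measurable sphere_prob"
      by (simp cong: measurable_cong_sets)
  qed
qed

lemma sphere_mean_sum:
  assumes "\<And>a. a \<in> A \<Longrightarrow> hpolyfun (d a) (f a)"
  shows "sphere_mean (\<lambda>x. \<Sum>a\<in>A. f a x) = (\<Sum>a\<in>A. sphere_mean (f a))"
proof -
  have "integrable sphere_prob (\<lambda>\<zeta>. indicator (sphere 0 1) \<zeta> *\<^sub>R f a (cvec \<zeta>))" if "a \<in> A" for a
    using hpolyfun_set_integrable_sphere[OF assms[OF that]] unfolding set_integrable_def .
  from Bochner_Integration.integral_sum[OF this] show ?thesis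
    unfolding sphere_mean_def set_lebesgue_integral_def scaleR_sum_right .
qed

lemma sphere_mean_add:
  assumes "hpolyfun d f" "hpolyfun e g"
  shows "sphere_mean (\<lambda>x. f x + g x) = sphere_mean f + sphere_mean g"
  unfolding sphere_mean_def
  by (intro set_integral_add hpolyfun_set_integrable_sphere[OF assms(1)]
        hpolyfun_set_integrable_sphere[OF assms(2)])

lemma sphere_mean_cmult: "sphere_mean (\<lambda>x. c * f x) = c * sphere_mean f"
  unfolding sphere_mean_def set_lebesgue_integral_def
  by (simp flip: mult_scaleR_right)

lemma sphere_mean_const: "sphere_mean (\<lambda>_ :: complex ^ 'n::finite. c) = c"
proof -
  have "measure (sphere_prob :: (real ^ 'n) measure) (sphere 0 1) = 1"
    by (simp add: measure_def emeasure_sphere_prob_sphere)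
  moreover have "integrable sphere_prob (indicat_real (sphere (0 :: real ^ 'n) 1))"
    by (rule finite_measure.integrable_const_bound[OF finite_measure_sphere_prob, of _ 1])
       (auto simp: indicator_def intro!: borel_measurable_indicator)
  ultimately show ?thesis
    unfolding sphere_mean_def set_lebesgue_integral_def
    by (subst integral_scaleR_left) simp_all
qed

lemma sphere_mean_cong:
  assumes "\<And>\<zeta>. norm \<zeta> = 1 \<Longrightarrow> f (cvec \<zeta>) = g (cvec \<zeta>)"
  shows "sphere_mean f = sphere_mean g"
  unfolding sphere_mean_def set_lebesgue_integral_def
  using assms by (intro Bochner_Integration.integral_cong) (auto simp: indicator_def)

section \<open>Rotational derivatives have mean zero\<close>

definition plane_rotation :: "'n \<Rightarrow> 'n \<Rightarrow> real \<Rightarrow> real ^ 'n::finite \<Rightarrow> real ^ 'n" where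
  "plane_rotation i j \<theta> x = (\<chi> k. if k = i then cos \<theta> * x $ i - sin \<theta> * x $ j
      else if k = j then sin \<theta> * x $ i + cos \<theta> * x $ j else x $ k)"

lemma orthogonal_plane_rotation:
  assumes "i \<noteq> j"
  shows "orthogonal_transformation (plane_rotation i j \<theta>)"
  unfolding orthogonal_transformation_def
proof (intro conjI allI)
  show "linear (plane_rotation i j \<theta>)"
    by (rule linearI) (auto simp: plane_rotation_def vec_eq_iff algebra_simps)
  fix v w :: "real ^ 'a"
  let ?r = "plane_rotation i j \<theta>"
  have split: "x \<bullet> y = x $ i * y $ i + x $ j * y $ j + (\<Sum>k\<in>UNIV - {i, j}. x $ k * y $ k)"
    for x y :: "real ^ 'a"
  proof -
    have "x \<bullet> y = (\<Sum>k\<in>insert i (insert j (UNIV - {i, j})). x $ k * y $ k)"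
      by (simp add: inner_vec_def insert_absorb insert_commute Un_insert_left flip: insert_is_Un)
         (intro sum.cong, auto)
    thus ?thesis using assms by simp
  qed
  have "?r v $ i * ?r w $ i + ?r v $ j * ?r w $ j
      = ((cos \<theta>)\<^sup>2 + (sin \<theta>)\<^sup>2) * (v $ i * w $ i + v $ j * w $ j)"
    using assms
    by (simp add: plane_rotation_def del: sin_cos_squared_add sin_cos_squared_add2 sin_cos_squared_add3)
       (simp add: algebra_simps power2_eq_square
         del: sin_cos_squared_add sin_cos_squared_add2 sin_cos_squared_add3)
  moreover have "(\<Sum>k\<in>UNIV - {i, j}. ?r v $ k * ?r w $ k) = (\<Sum>k\<in>UNIV - {i, j}. v $ k * w $ k)"
    by (intro sum.cong) (auto simp: plane_rotation_def)
  ultimately show "?r v \<bullet> ?r w = v \<bullet> w"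
    unfolding split[of "?r v"] split[of v] by simp
qed

text \<open>
  The infinitesimal generator of the rotations in the \<open>(i, j)\<close>-plane.
\<close>

definition angular_deriv ::
    "'n \<Rightarrow> 'n \<Rightarrow> (complex ^ 'n::finite \<Rightarrow> complex) \<Rightarrow> complex ^ 'n \<Rightarrow> complex" where
  "angular_deriv i j f x = x $ i * partial_deriv j f x - x $ j * partial_deriv i f x"

lemma hpolyfun_angular_deriv:
  assumes "hpolyfun d f"
  shows "hpolyfun (1 + (d - 1)) (angular_deriv i j f)"
proof -
  have "hpolyfun (1 + (d - 1)) (\<lambda>x. x $ i * partial_deriv j f x + (-1) * (x $ j * partial_deriv i f x))"
    by (intro hpolyfun_add hpolyfun_cmult hpolyfun_mult hpolyfun_coord hpolyfun_partial_deriv assms)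
  thus ?thesis by (simp add: angular_deriv_def[abs_def])
qed

lemma has_vector_derivative_plane_rotation:
  assumes f: "hpolyfun d f" and "i \<noteq> j"
  shows "((\<lambda>\<theta>. f (cvec (plane_rotation i j \<theta> \<zeta>))) has_vector_derivative
           angular_deriv i j f (cvec (plane_rotation i j \<theta> \<zeta>))) (at \<theta>)"
proof -
  define x where "x = cvec (plane_rotation i j \<theta> \<zeta>)"
  \<comment> \<open>The velocity of the rotated point.\<close>
  define v where "v = (\<chi> k. if k = i then - x $ j else if k = j then x $ i else 0)"
  have "((\<lambda>\<theta>. cvec (plane_rotation i j \<theta> \<zeta>)) has_derivative (\<lambda>h. h *\<^sub>R v)) (at \<theta>)"
  proof (subst has_derivative_componentwise_within, intro ballI)
    fix b :: "complex ^ 'a" assume "b \<in> Basis"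
    then obtain k c where b: "b = axis k c" "c \<in> Basis" by (auto simp: Basis_vec_def)
    have re: "((\<lambda>\<theta>. plane_rotation i j \<theta> \<zeta> $ k) has_derivative (\<lambda>h. h * Re (v $ k))) (at \<theta>)"
      using \<open>i \<noteq> j\<close>
      by (auto simp: plane_rotation_def v_def x_def cvec_def intro!: derivative_eq_intros)
         (auto simp: algebra_simps)
    have "Im (v $ k) = 0" by (simp add: v_def x_def cvec_def)
    with re b(2) show "((\<lambda>\<theta>. cvec (plane_rotation i j \<theta> \<zeta>) \<bullet> b) has_derivative (\<lambda>h. h *\<^sub>R v \<bullet> b)) (at \<theta>)"
      by (auto simp: b(1) inner_axis cvec_def Basis_complex_def)
  qed
  from has_derivative_compose[OF this hpolyfun_has_derivative[OF f]]
  have "((\<lambda>\<theta>. f (cvec (plane_rotation i j \<theta> \<zeta>))) has_derivative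
          (\<lambda>h. \<Sum>k\<in>UNIV. (h *\<^sub>R v) $ k * partial_deriv k f x)) (at \<theta>)"
    by (simp add: x_def)
  moreover have "(\<Sum>k\<in>UNIV. (h *\<^sub>R v) $ k * partial_deriv k f x) = h *\<^sub>R angular_deriv i j f x" for h
  proof -
    have "(\<Sum>k\<in>UNIV. v $ k * partial_deriv k f x) = (\<Sum>k\<in>{i, j}. v $ k * partial_deriv k f x)"
      by (intro sum.mono_neutral_right) (auto simp: v_def)
    also have "\<dots> = angular_deriv i j f x"
      using \<open>i \<noteq> j\<close> by (simp add: v_def angular_deriv_def)
    finally show ?thesis by (simp flip: scaleR_sum_right)
  qed
  ultimately show ?thesis by (simp add: has_vector_derivative_def x_def)
qed

lemma sphere_mean_plane_rotation:
  assumes "hpolyfun d f" "i \<noteq> j"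
  shows "(LINT \<zeta>:sphere 0 1|sphere_prob. f (cvec (plane_rotation i j \<theta> \<zeta>))) = sphere_mean f"
proof -
  let ?R = "plane_rotation i j \<theta>"
  have R: "orthogonal_transformation ?R" by (rule orthogonal_plane_rotation[OF assms(2)])
  hence "?R \<in> borel_measurable borel"
    by (rule borel_measurable_orthogonal_transformation)
  hence meas: "?R \<in> measurable sphere_prob borel"
    by (simp cong: measurable_cong_sets)
  have "sphere_mean f
      = (LINT \<zeta>|distr sphere_prob borel ?R. indicator (sphere 0 1) \<zeta> *\<^sub>R f (cvec \<zeta>))"
    by (simp add: sphere_prob_orthogonal_invariant[OF R] sphere_mean_def set_lebesgue_integral_def)
  also have "\<dots> = (LINT \<zeta>|sphere_prob. indicator (sphere 0 1) (?R \<zeta>) *\<^sub>R f (cvec (?R \<zeta>)))"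
    by (intro integral_distr meas borel_measurable_scaleR borel_measurable_indicator
          hpolyfun_cvec_measurable[OF assms(1)]) simp
  also have "\<dots> = (LINT \<zeta>:sphere 0 1|sphere_prob. f (cvec (?R \<zeta>)))"
    unfolding set_lebesgue_integral_def
    by (intro Bochner_Integration.integral_cong)
       (auto simp: indicator_def orthogonal_transformation_norm[OF R])
  finally show ?thesis ..
qed

text \<open>
  The mean of \<open>f\<close> composed with a rotation does not depend on the angle, so its derivative at
  angle zero vanishes. The derivative passes under the integral by dominated convergence,
  because \<^const>\<open>angular_deriv\<close> of \<open>f\<close> is bounded on the sphere and so bounds the difference
  quotients.
\<close>

lemma sphere_mean_angular_deriv:
  assumes f: "hpolyfun d f"
  shows "sphere_mean (angular_deriv i j f) = 0"
proof (cases "i = j")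
  case True
  thus ?thesis
    by (simp add: angular_deriv_def[abs_def] sphere_mean_def set_lebesgue_integral_def)
next
  case False
  note R = orthogonal_plane_rotation[OF False]
  define \<phi> where "\<phi> \<theta> \<zeta> = f (cvec (plane_rotation i j \<theta> \<zeta>))" for \<theta> \<zeta>
  define q where "q n \<zeta> = real (Suc n) *\<^sub>R (indicator (sphere 0 1) \<zeta> *\<^sub>R (\<phi> (1 / real (Suc n)) \<zeta> - \<phi> 0 \<zeta>))" for n \<zeta>
  have rot0: "plane_rotation i j 0 \<zeta> = \<zeta>" for \<zeta> :: "real ^ 'a"
    by (simp add: plane_rotation_def vec_eq_iff)
  have deriv: "((\<lambda>\<theta>. \<phi> \<theta> \<zeta>) has_vector_derivative
      angular_deriv i j f (cvec (plane_rotation i j \<theta> \<zeta>))) (at \<theta> within S)" for \<theta> \<zeta> S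
    unfolding \<phi>_def
    using has_vector_derivative_plane_rotation[OF f False] has_vector_derivative_at_within by blast
  obtain K where K: "\<And>\<zeta>. norm \<zeta> = 1 \<Longrightarrow> norm (angular_deriv i j f (cvec \<zeta>)) \<le> K"
    using hpolyfun_bounded_on_sphere[OF hpolyfun_angular_deriv[OF f]] by blast
  have K0: "K \<ge> 0"
    using K[of "axis i 1"] norm_ge_zero order_trans by (metis norm_axis_1)
  have borel_sphere_prob: "borel_measurable sphere_prob = borel_measurable (borel :: (real ^ 'a) measure)"
    by (rule measurable_cong_sets) simp_all
  have \<phi>_meas: "\<phi> \<theta> \<in> borel_measurable borel" for \<theta>
    using measurable_compose[OF borel_measurable_orthogonal_transformation[OF R] hpolyfun_cvec_measurable[OF f]]
    by (simp add: \<phi>_def[abs_def])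
  have \<phi>_int: "set_integrable sphere_prob (sphere 0 1) (\<phi> \<theta>)" for \<theta>
  proof -
    obtain B where B: "\<And>\<zeta>. norm \<zeta> = 1 \<Longrightarrow> norm (f (cvec \<zeta>)) \<le> B"
      using hpolyfun_bounded_on_sphere[OF f] by blast
    have "norm (indicator (sphere 0 1) \<zeta> *\<^sub>R \<phi> \<theta> \<zeta>) \<le> max 0 B" for \<zeta>
      using B orthogonal_transformation_norm[OF R]
      by (auto simp: indicator_def \<phi>_def max.coboundedI2)
    moreover have "(\<lambda>\<zeta>. indicator (sphere 0 1) \<zeta> *\<^sub>R \<phi> \<theta> \<zeta>) \<in> borel_measurable sphere_prob"
      unfolding borel_sphere_prob
      by (intro borel_measurable_scaleR borel_measurable_indicator \<phi>_meas) simp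
    ultimately show ?thesis unfolding set_integrable_def
      by (intro finite_measure.integrable_const_bound[OF finite_measure_sphere_prob, of _ "max 0 B"]) auto
  qed
  have int_q: "integral\<^sup>L sphere_prob (q n) = 0" for n
  proof -
    have "integral\<^sup>L sphere_prob (q n) = real (Suc n) *\<^sub>R
       (LINT \<zeta>:sphere 0 1|sphere_prob. \<phi> (1 / real (Suc n)) \<zeta> - \<phi> 0 \<zeta>)"
      unfolding q_def set_lebesgue_integral_def
      by (rule integral_scaleR_right)
    also have "(LINT \<zeta>:sphere 0 1|sphere_prob. \<phi> (1 / real (Suc n)) \<zeta> - \<phi> 0 \<zeta>)
        = sphere_mean f - sphere_mean f"
      using set_integral_diff(2)[OF \<phi>_int \<phi>_int]
        sphere_mean_plane_rotation[OF f False]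
      by (simp add: \<phi>_def)
    finally show ?thesis by simp
  qed
  have "(\<lambda>n. integral\<^sup>L sphere_prob (q n)) \<longlonglongrightarrow>
      (LINT \<zeta>|sphere_prob. indicator (sphere 0 1) \<zeta> *\<^sub>R angular_deriv i j f (cvec \<zeta>))"
  proof (rule integral_dominated_convergence[where w = "\<lambda>_. K"])
    show "integrable sphere_prob (\<lambda>_ :: real ^ 'a. K)"
      by (rule finite_measure.integrable_const[OF finite_measure_sphere_prob])
    show "(\<lambda>\<zeta>. indicator (sphere 0 1) \<zeta> *\<^sub>R angular_deriv i j f (cvec \<zeta>)) \<in> borel_measurable sphere_prob"
      using hpolyfun_set_integrable_sphere[OF hpolyfun_angular_deriv[OF f]]
      by (auto simp: set_integrable_def)
    show "q n \<in> borel_measurable sphere_prob" for n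
      unfolding q_def borel_sphere_prob
      by (intro borel_measurable_scaleR borel_measurable_indicator borel_measurable_diff
            borel_measurable_const \<phi>_meas) simp
    show "AE \<zeta> in sphere_prob. (\<lambda>n. q n \<zeta>) \<longlonglongrightarrow>
        indicator (sphere 0 1) \<zeta> *\<^sub>R angular_deriv i j f (cvec \<zeta>)"
    proof (rule AE_I2)
      fix \<zeta>
      have "((\<lambda>h. (\<phi> h \<zeta> - \<phi> 0 \<zeta>) /\<^sub>R h) \<longlongrightarrow> angular_deriv i j f (cvec \<zeta>)) (at 0)"
      proof (subst Lim_null, rule tendsto_norm_zero_cancel, rule Lim_transform_eventually)
        let ?v = "angular_deriv i j f (cvec \<zeta>)"
        show "((\<lambda>h. norm (\<phi> h \<zeta> - \<phi> 0 \<zeta> - h *\<^sub>R ?v) / \<bar>h\<bar>) \<longlongrightarrow> 0) (at 0)"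
          using deriv[of \<zeta> 0 UNIV]
          by (simp add: has_vector_derivative_def has_derivative_at rot0)
        have "norm (\<phi> h \<zeta> - \<phi> 0 \<zeta> - h *\<^sub>R ?v) / \<bar>h\<bar> = norm ((\<phi> h \<zeta> - \<phi> 0 \<zeta>) /\<^sub>R h - ?v)"
          if "h \<noteq> 0" for h
        proof -
          have "(\<phi> h \<zeta> - \<phi> 0 \<zeta>) /\<^sub>R h - ?v = (\<phi> h \<zeta> - \<phi> 0 \<zeta> - h *\<^sub>R ?v) /\<^sub>R h"
            using that by (simp add: scaleR_diff_right)
          thus ?thesis by (simp add: divide_inverse mult.commute)
        qed
        thus "\<forall>\<^sub>F h in at 0. norm (\<phi> h \<zeta> - \<phi> 0 \<zeta> - h *\<^sub>R ?v) / \<bar>h\<bar>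
              = norm ((\<phi> h \<zeta> - \<phi> 0 \<zeta>) /\<^sub>R h - ?v)"
          by (auto simp: eventually_at_filter)
      qed
      moreover have "filterlim (\<lambda>n. 1 / real (Suc n)) (at 0) sequentially"
        using LIMSEQ_inverse_real_of_nat by (auto simp: filterlim_at inverse_eq_divide)
      ultimately have "(\<lambda>n. (\<phi> (1 / real (Suc n)) \<zeta> - \<phi> 0 \<zeta>) /\<^sub>R (1 / real (Suc n)))
          \<longlonglongrightarrow> angular_deriv i j f (cvec \<zeta>)"
        by (rule filterlim_compose)
      from tendsto_scaleR[OF tendsto_const[of "indicator (sphere 0 1) \<zeta>"] this]
      show "(\<lambda>n. q n \<zeta>) \<longlonglongrightarrow> indicator (sphere 0 1) \<zeta> *\<^sub>R angular_deriv i j f (cvec \<zeta>)"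
        by (simp add: q_def mult.commute)
    qed
    show "AE \<zeta> in sphere_prob. norm (q n \<zeta>) \<le> K" for n
    proof (rule AE_I2)
      fix \<zeta> :: "real ^ 'a"
      show "norm (q n \<zeta>) \<le> K"
      proof (cases "norm \<zeta> = 1")
        case True
        have "norm (\<phi> (1 / real (Suc n)) \<zeta> - \<phi> 0 \<zeta>) \<le> K * norm (1 / real (Suc n) - 0)"
        proof (rule differentiable_bound[of UNIV])
          fix \<theta> :: real
          show "((\<lambda>\<theta>. \<phi> \<theta> \<zeta>) has_derivative
             (\<lambda>h. h *\<^sub>R angular_deriv i j f (cvec (plane_rotation i j \<theta> \<zeta>)))) (at \<theta> within UNIV)"
            using deriv by (simp add: has_vector_derivative_def)
          have "norm (angular_deriv i j f (cvec (plane_rotation i j \<theta> \<zeta>))) \<le> K"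
            using True by (intro K) (simp add: orthogonal_transformation_norm[OF R])
          thus "onorm (\<lambda>h. h *\<^sub>R angular_deriv i j f (cvec (plane_rotation i j \<theta> \<zeta>))) \<le> K"
            using K0 by (intro onorm_bound) (simp_all add: mult.commute[of "\<bar>_\<bar>"] mult_right_mono)
        qed auto
        moreover have "norm (q n \<zeta>) = real (Suc n) * norm (\<phi> (1 / real (Suc n)) \<zeta> - \<phi> 0 \<zeta>)"
          using True by (simp add: q_def del: of_nat_Suc)
        ultimately show ?thesis by (simp add: field_simps del: of_nat_Suc)
      qed (use K0 in \<open>simp add: q_def\<close>)
    qed
  qed
  hence "(LINT \<zeta>|sphere_prob. indicator (sphere 0 1) \<zeta> *\<^sub>R angular_deriv i j f (cvec \<zeta>)) = 0"
    by (simp add: int_q LIMSEQ_const_iff)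
  thus ?thesis by (simp add: sphere_mean_def set_lebesgue_integral_def)
qed

section \<open>The spherical mean of a Laplacian\<close>

lemma csq_cvec: "csq (cvec \<zeta>) = of_real ((norm \<zeta>)\<^sup>2)"
  by (simp add: csq_def cvec_def norm_vec_def L2_set_def sum_nonneg)

text \<open>
  Modulo rotational derivatives, the Laplacian acts on forms of degree \<open>d\<close> restricted to the
  sphere as the scalar \<open>d (n + d - 2)\<close>. Applying the generator to \<open>x\<^sub>i \<partial>\<^sub>j f\<close> produces second
  derivatives \<open>x\<^sub>i\<^sup>2 \<partial>\<^sub>j \<partial>\<^sub>j f\<close>, which add up to \<open>|x|\<^sup>2 \<Delta>f\<close>, and mixed terms that Euler's
  identity, applied to \<open>f\<close> and to \<open>\<partial>\<^sub>j f\<close>, turns into multiples of \<open>f\<close>.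
\<close>

lemma sum_angular_deriv:
  fixes f :: "complex ^ 'n::finite \<Rightarrow> complex"
  assumes f: "hpolyfun d f"
  shows "(\<Sum>j\<in>UNIV. \<Sum>i\<in>UNIV. angular_deriv i j (\<lambda>x. x $ i * partial_deriv j f x) x)
    = csq x * laplacian f x - of_nat d * (of_nat CARD('n) + of_nat d - 2) * f x"
proof (cases "d = 0")
  case True
  hence "partial_deriv i f = (\<lambda>_. 0)" for i
    using hpolyfun_partial_deriv_degree[OF f] by blast
  thus ?thesis using True by (simp add: angular_deriv_def laplacian_def)
next
  case False
  have "(\<Sum>i\<in>UNIV. angular_deriv i j (\<lambda>x. x $ i * partial_deriv j f x) x)
      = x $ j * partial_deriv j f x + csq x * partial_deriv j (partial_deriv j f) x
        - of_nat CARD('n) * (x $ j * partial_deriv j f x)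
        - (of_nat d - 1) * (x $ j * partial_deriv j f x)" for j
  proof -
    note pd = partial_deriv_mult[OF hpolyfun_coord hpolyfun_partial_deriv[OF f]]
    have "(\<Sum>i\<in>UNIV. angular_deriv i j (\<lambda>x. x $ i * partial_deriv j f x) x)
      = (\<Sum>i\<in>UNIV. (if j = i then x $ i * partial_deriv j f x else 0)
           + (x $ i)\<^sup>2 * partial_deriv j (partial_deriv j f) x
           - x $ j * partial_deriv j f x
           - x $ j * (x $ i * partial_deriv i (partial_deriv j f) x))"
      by (intro sum.cong refl)
         (auto simp: angular_deriv_def pd partial_deriv_coord algebra_simps power2_eq_square)
    also have "\<dots> = x $ j * partial_deriv j f x + csq x * partial_deriv j (partial_deriv j f) x
        - of_nat CARD('n) * (x $ j * partial_deriv j f x)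
        - x $ j * (\<Sum>i\<in>UNIV. x $ i * partial_deriv i (partial_deriv j f) x)"
      by (simp add: sum.distrib sum_subtractf csq_def flip: sum_distrib_left sum_distrib_right)
    also have "(\<Sum>i\<in>UNIV. x $ i * partial_deriv i (partial_deriv j f) x)
        = (of_nat d - 1) * partial_deriv j f x"
      using False by (simp add: euler_identity[OF hpolyfun_partial_deriv[OF f]] of_nat_diff)
    finally show ?thesis by simp
  qed
  hence "(\<Sum>i\<in>UNIV. angular_deriv i j (\<lambda>x. x $ i * partial_deriv j f x) x)
      = csq x * partial_deriv j (partial_deriv j f) x
        + (1 - of_nat CARD('n) - (of_nat d - 1)) * (x $ j * partial_deriv j f x)" for j
    by (simp add: algebra_simps)
  hence "(\<Sum>j\<in>UNIV. \<Sum>i\<in>UNIV. angular_deriv i j (\<lambda>x. x $ i * partial_deriv j f x) x)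
      = csq x * laplacian f x + (1 - of_nat CARD('n) - (of_nat d - 1)) * (of_nat d * f x)"
    by (simp only: sum.distrib sum_distrib_left[symmetric] laplacian_def euler_identity[OF f])
  thus ?thesis by (simp add: algebra_simps)
qed

lemma hpolyfun_laplacian: "hpolyfun d f \<Longrightarrow> hpolyfun (d - 1 - 1) (laplacian f)"
  unfolding laplacian_def[abs_def] by (intro hpolyfun_sum hpolyfun_partial_deriv)

text \<open>
  The previous identity averaged over the sphere, where \<open>|x|\<^sup>2 = 1\<close>.
\<close>

lemma sphere_mean_laplacian:
  fixes f :: "complex ^ 'n::finite \<Rightarrow> complex"
  assumes f: "hpolyfun d f"
  shows "sphere_mean (laplacian f) = of_nat d * (of_nat CARD('n) + of_nat d - 2) * sphere_mean f"
proof -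
  define c :: complex where "c = of_nat d * (of_nat CARD('n) + of_nat d - 2)"
  let ?T = "\<lambda>j i. angular_deriv i j (\<lambda>x. x $ i * partial_deriv j f x)"
  have xf: "hpolyfun (1 + (d - 1)) (\<lambda>x. x $ i * partial_deriv j f x)" for i j
    by (intro hpolyfun_mult hpolyfun_coord hpolyfun_partial_deriv f)
  have "0 = (\<Sum>j\<in>UNIV. \<Sum>i\<in>UNIV. sphere_mean (?T j i))"
    by (simp add: sphere_mean_angular_deriv[OF xf])
  also have "\<dots> = sphere_mean (\<lambda>x. \<Sum>j\<in>UNIV. \<Sum>i\<in>UNIV. ?T j i x)"
    by (simp add: sphere_mean_sum[OF hpolyfun_angular_deriv[OF xf]]
       sphere_mean_sum[OF hpolyfun_sum[OF hpolyfun_angular_deriv[OF xf]]])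
  also have "\<dots> = sphere_mean (\<lambda>x. laplacian f x + (- c) * f x)"
    by (intro sphere_mean_cong) (simp add: sum_angular_deriv[OF f] csq_cvec c_def)
  also have "\<dots> = sphere_mean (laplacian f) - c * sphere_mean f"
    by (subst sphere_mean_add[OF hpolyfun_laplacian[OF f] hpolyfun_cmult[OF f]])
       (simp only: sphere_mean_cmult, simp)
  finally show ?thesis by (simp add: c_def)
qed

section \<open>Coefficients of forms and the Fischer pairing\<close>

lemma mdeg_add_axis [simp]: "mdeg (\<alpha> + axis i 1) = Suc (mdeg \<alpha>)"
  by (simp add: mdeg_def axis_def sum.distrib)

lemma mfact_add_axis: "mfact (\<alpha> + axis i 1) = (\<alpha> $ i + 1) * mfact \<alpha>"
proof -
  have "mfact (\<alpha> + axis i 1) = (\<Prod>j\<in>UNIV. (if j = i then \<alpha> $ i + 1 else 1) * fact (\<alpha> $ j))"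
    unfolding mfact_def by (intro prod.cong) (auto simp: axis_def)
  thus ?thesis by (simp add: prod.distrib mfact_def)
qed

lemma mpow_add_axis: "mpow x (\<alpha> + axis i 1) = x $ i * mpow x \<alpha>"
proof -
  have "mpow x (\<alpha> + axis i 1) = (\<Prod>j\<in>UNIV. (if j = i then x $ i else 1) * (x $ j) ^ (\<alpha> $ j))"
    unfolding mpow_def by (intro prod.cong) (auto simp: axis_def)
  thus ?thesis by (simp add: prod.distrib mpow_def)
qed

text \<open>
  Shifting an index by a unit vector is a bijection from the indices of degree \<open>k\<close> onto those
  of degree \<open>k + 1\<close> with positive \<open>i\<close>-th entry; the weight \<open>\<beta>\<^sub>i\<close> removes the others. The same
  shift underlies differentiation of forms, the multinomial theorem and the recursion of the
  Fischer pairing.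
\<close>

lemma sum_mdeg_shift:
  fixes F :: "nat ^ 'n::finite \<Rightarrow> 'b::comm_semiring_1"
  shows "(\<Sum>\<alpha> | mdeg \<alpha> = k. of_nat (\<alpha> $ i + 1) * F (\<alpha> + axis i 1))
       = (\<Sum>\<beta> | mdeg \<beta> = Suc k. of_nat (\<beta> $ i) * F \<beta>)"
proof -
  have inv: "\<beta> - axis i 1 + axis i 1 = \<beta>" if "\<beta> $ i \<noteq> 0" for \<beta> :: "nat ^ 'n"
    using that by (auto simp: vec_eq_iff axis_def)
  have "(\<Sum>\<alpha> | mdeg \<alpha> = k. of_nat (\<alpha> $ i + 1) * F (\<alpha> + axis i 1))
      = (\<Sum>\<beta> | mdeg \<beta> = Suc k \<and> \<beta> $ i \<noteq> 0. of_nat (\<beta> $ i) * F \<beta>)"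
  proof (rule sum.reindex_bij_witness[of _ "\<lambda>\<beta>. \<beta> - axis i 1" "\<lambda>\<alpha>. \<alpha> + axis i 1"])
    fix \<beta> :: "nat ^ 'n" assume \<beta>: "\<beta> \<in> {\<beta>. mdeg \<beta> = Suc k \<and> \<beta> $ i \<noteq> 0}"
    thus "\<beta> - axis i 1 + axis i 1 = \<beta>" using inv by blast
    have "Suc (mdeg (\<beta> - axis i 1)) = mdeg \<beta>"
      using \<beta> inv[of \<beta>] mdeg_add_axis[of "\<beta> - axis i 1" i] by simp
    thus "\<beta> - axis i 1 \<in> {\<alpha>. mdeg \<alpha> = k}" using \<beta> by simp
  qed (simp_all flip: One_nat_def)
  also have "\<dots> = (\<Sum>\<beta> | mdeg \<beta> = Suc k. of_nat (\<beta> $ i) * F \<beta>)"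
    by (intro sum.mono_neutral_left) (auto simp: finite_mdeg_eq)
  finally show ?thesis .
qed

lemma partial_deriv_mpow:
  "partial_deriv i (\<lambda>x. mpow x \<beta>) x = of_nat (\<beta> $ i) * mpow x (\<beta> - axis i 1)"
proof -
  let ?P = "\<Prod>j\<in>UNIV - {i}. (x $ j) ^ (\<beta> $ j)"
  have eq: "mpow (x + axis i t) \<beta> = (x $ i + t) ^ (\<beta> $ i) * ?P" for t
  proof -
    have "mpow (x + axis i t) \<beta>
        = (x $ i + t) ^ (\<beta> $ i) * (\<Prod>j\<in>UNIV - {i}. ((x + axis i t) $ j) ^ (\<beta> $ j))"
      unfolding mpow_def by (subst prod.remove[of _ i]) auto
    thus ?thesis by (auto simp: axis_def intro!: prod.cong)
  qed
  have "mpow x (\<beta> - axis i 1) = (x $ i) ^ (\<beta> $ i - 1) * ?P"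
    unfolding mpow_def by (subst prod.remove[of _ i]) (auto simp: axis_def intro!: prod.cong)
  moreover have "((\<lambda>t. (x $ i + t) ^ (\<beta> $ i) * ?P) has_field_derivative
      of_nat (\<beta> $ i) * ((x $ i) ^ (\<beta> $ i - 1) * ?P)) (at 0)"
    by (auto intro!: derivative_eq_intros)
  ultimately show ?thesis
    unfolding partial_deriv_def eq by (simp add: DERIV_imp_deriv)
qed

definition hform :: "nat \<Rightarrow> (nat ^ 'n::finite \<Rightarrow> complex) \<Rightarrow> complex ^ 'n \<Rightarrow> complex" where
  "hform k c x = (\<Sum>\<alpha> | mdeg \<alpha> = k. c \<alpha> * mpow x \<alpha>)"

lemma hpolyfun_hform: "hpolyfun k (hform k c)"
proof -
  have "hpolyfun k (\<lambda>x. c \<alpha> * mpow x \<alpha>)" if "mdeg \<alpha> = k" for \<alpha>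
    using hpolyfun_cmult[OF hpolyfun_mpow[of \<alpha>]] that by simp
  thus ?thesis unfolding hform_def[abs_def] by (intro hpolyfun_sum) auto
qed

lemma hpolyfun_if_homogeneous_poly: "homogeneous_poly m q \<Longrightarrow> hpolyfun m q"
  using hpolyfun_hform by (auto simp: homogeneous_poly_def hform_def[abs_def] simp flip: fun_eq_iff)

lemma partial_deriv_hform:
  "partial_deriv i (hform (Suc k) c) = hform k (\<lambda>\<alpha>. of_nat (\<alpha> $ i + 1) * c (\<alpha> + axis i 1))"
proof
  fix x
  have hp: "hpolyfun (Suc k) (\<lambda>x. c \<beta> * mpow x \<beta>)" if "\<beta> \<in> {\<beta>. mdeg \<beta> = Suc k}" for \<beta>
    using hpolyfun_cmult[OF hpolyfun_mpow[of \<beta>]] that by simp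
  have "partial_deriv i (hform (Suc k) c) x
      = (\<Sum>\<beta> | mdeg \<beta> = Suc k. partial_deriv i (\<lambda>x. c \<beta> * mpow x \<beta>) x)"
    unfolding hform_def[abs_def]
    by (subst partial_deriv_sum[OF hp]) auto
  also have "\<dots> = (\<Sum>\<beta> | mdeg \<beta> = Suc k. of_nat (\<beta> $ i) * (c \<beta> * mpow x (\<beta> - axis i 1)))"
    by (intro sum.cong refl)
       (simp add: partial_deriv_mult[OF hpolyfun_const hpolyfun_mpow] partial_deriv_mpow mult_ac)
  also have "\<dots> = hform k (\<lambda>\<alpha>. of_nat (\<alpha> $ i + 1) * c (\<alpha> + axis i 1)) x"
    unfolding sum_mdeg_shift[symmetric] hform_def by (simp add: mult_ac)
  finally show "partial_deriv i (hform (Suc k) c) x = \<dots>" .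
qed

text \<open>
  The pairing is bilinear, to match the bilinear product of functions in the recursions for
  spherical means; for the Hermitian one, \<open>d\<close> is a family of conjugated coefficients.
\<close>

definition fischer_form :: "nat \<Rightarrow> (nat ^ 'n::finite \<Rightarrow> complex) \<Rightarrow> (nat ^ 'n \<Rightarrow> complex) \<Rightarrow> complex" where
  "fischer_form k c d = (\<Sum>\<alpha> | mdeg \<alpha> = k. of_nat (mfact \<alpha>) * c \<alpha> * d \<alpha>)"

text \<open>
  Multiplication by \<open>x\<^sub>i\<close> is adjoint to \<open>\<partial>\<^sub>i\<close>, so by Euler's identity the pairings of the partial
  derivatives add up to the degree times the pairing.
\<close>

lemma fischer_form_derivatives:
  "(\<Sum>i\<in>UNIV. fischer_form k (\<lambda>\<alpha>. of_nat (\<alpha> $ i + 1) * c (\<alpha> + axis i 1))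
                              (\<lambda>\<alpha>. of_nat (\<alpha> $ i + 1) * d (\<alpha> + axis i 1)))
   = of_nat (Suc k) * fischer_form (Suc k) c d"
proof -
  let ?F = "\<lambda>\<beta>. of_nat (mfact \<beta>) * c \<beta> * d \<beta>"
  have "fischer_form k (\<lambda>\<alpha>. of_nat (\<alpha> $ i + 1) * c (\<alpha> + axis i 1))
                       (\<lambda>\<alpha>. of_nat (\<alpha> $ i + 1) * d (\<alpha> + axis i 1))
      = (\<Sum>\<beta> | mdeg \<beta> = Suc k. of_nat (\<beta> $ i) * ?F \<beta>)" for i
    unfolding sum_mdeg_shift[symmetric] fischer_form_def
    by (intro sum.cong refl) (simp only: mfact_add_axis of_nat_mult mult_ac)
  hence "(\<Sum>i\<in>UNIV. fischer_form k (\<lambda>\<alpha>. of_nat (\<alpha> $ i + 1) * c (\<alpha> + axis i 1))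
                              (\<lambda>\<alpha>. of_nat (\<alpha> $ i + 1) * d (\<alpha> + axis i 1)))
      = (\<Sum>i\<in>UNIV. \<Sum>\<beta> | mdeg \<beta> = Suc k. of_nat (\<beta> $ i) * ?F \<beta>)" by simp
  also have "\<dots> = (\<Sum>\<beta> | mdeg \<beta> = Suc k. of_nat (mdeg \<beta>) * ?F \<beta>)"
    by (subst sum.swap) (intro sum.cong refl, simp only: mdeg_def of_nat_sum sum_distrib_right)
  finally show ?thesis by (simp add: fischer_form_def sum_distrib_left)
qed

section \<open>Orthogonality of harmonic forms on the sphere\<close>

text \<open>
  For harmonic factors only the mixed term of \<open>\<Delta>(f g)\<close> survives, so the mean of \<open>f g\<close> reduces
  to means of products of partial derivatives, which are again harmonic and of lower degree.
\<close>

lemma sphere_mean_harmonic_mult: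
  fixes f g :: "complex ^ 'n::finite \<Rightarrow> complex"
  assumes f: "hpolyfun k f" "laplacian f = (\<lambda>_. 0)" and g: "hpolyfun l g" "laplacian g = (\<lambda>_. 0)"
  shows "of_nat (k + l) * (of_nat CARD('n) + of_nat (k + l) - 2) * sphere_mean (\<lambda>x. f x * g x)
       = 2 * (\<Sum>i\<in>UNIV. sphere_mean (\<lambda>x. partial_deriv i f x * partial_deriv i g x))"
proof -
  have "of_nat (k + l) * (of_nat CARD('n) + of_nat (k + l) - 2) * sphere_mean (\<lambda>x. f x * g x)
      = sphere_mean (laplacian (\<lambda>x. f x * g x))"
    by (rule sphere_mean_laplacian[OF hpolyfun_mult[OF f(1) g(1)], symmetric])
  also have "laplacian (\<lambda>x. f x * g x)
      = (\<lambda>x. 2 * (\<Sum>i\<in>UNIV. partial_deriv i f x * partial_deriv i g x))"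
    by (rule ext) (simp add: laplacian_mult[OF f(1) g(1)] f(2) g(2))
  finally show ?thesis
    by (simp only: sphere_mean_cmult
      sphere_mean_sum[OF hpolyfun_mult[OF hpolyfun_partial_deriv[OF f(1)] hpolyfun_partial_deriv[OF g(1)]]])
qed

text \<open>
  Differentiating lowers both degrees by one and keeps them different, until one factor is
  constant and its derivatives vanish. The dimension is at least two so that the scalar
  \<open>d (n + d - 2)\<close> is nonzero for every \<open>d > 0\<close>.
\<close>

lemma sphere_mean_harmonic_orthogonal:
  fixes f g :: "complex ^ 'n::finite \<Rightarrow> complex"
  assumes "CARD('n) \<ge> 2" "k \<noteq> l"
    and "hpolyfun k f" "laplacian f = (\<lambda>_. 0)" and "hpolyfun l g" "laplacian g = (\<lambda>_. 0)"
  shows "sphere_mean (\<lambda>x. f x * g x) = 0"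
  using assms(2-)
proof (induction k arbitrary: l f g)
  have nz: "of_nat d * (of_nat CARD('n) + of_nat d - 2) \<noteq> (0 :: complex)" if "d > 0" for d
  proof -
    have "of_nat CARD('n) + of_nat d - 2 = (of_nat (CARD('n) + d - 2) :: complex)"
      using assms(1) by simp
    thus ?thesis using assms(1) that
      by (simp only: mult_eq_0_iff of_nat_eq_0_iff) linarith
  qed
  {
    case 0
    have "partial_deriv i f = (\<lambda>_. 0)" for i
      using hpolyfun_partial_deriv_degree[OF 0(2)] by blast
    with sphere_mean_harmonic_mult[OF 0(2-5)] nz[of l] 0(1) show ?case
      by (simp add: sphere_mean_const)
  next
    case (Suc k)
    have "sphere_mean (\<lambda>x. partial_deriv i f x * partial_deriv i g x) = 0" for i
    proof (cases l)
      case 0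
      hence "partial_deriv i g = (\<lambda>_. 0)"
        using hpolyfun_partial_deriv_degree[OF Suc.prems(4)] by blast
      thus ?thesis by (simp add: sphere_mean_const)
    next
      case (Suc l')
      show ?thesis
      proof (rule Suc.IH)
        show "k \<noteq> l'" using Suc Suc.prems(1) by simp
        show "hpolyfun k (partial_deriv i f)" "hpolyfun l' (partial_deriv i g)"
          using hpolyfun_partial_deriv[OF Suc.prems(2)] hpolyfun_partial_deriv[OF Suc.prems(4)] Suc
          by simp_all
        show "laplacian (partial_deriv i f) = (\<lambda>_. 0)" "laplacian (partial_deriv i g) = (\<lambda>_. 0)"
          using Suc.prems by (auto intro: laplacian_partial_deriv_eq_0)
      qed
    qed
    with sphere_mean_harmonic_mult[OF Suc.prems(2-5)] nz[of "Suc k + l"] show ?case by simp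
  }
qed

text \<open>
  In equal degrees, the means and the Fischer pairing satisfy the same recursion up to a scalar:
  from degree \<open>k\<close> to \<open>k + 1\<close> the quotient of the pairing by the mean gains the factor
  \<open>(2k + 2) (n + 2k) / (2 (k + 1)) = n + 2k\<close>.
\<close>

lemma sphere_mean_harmonic_eq_fischer:
  fixes c d :: "nat ^ 'n::finite \<Rightarrow> complex"
  assumes "laplacian (hform k c) = (\<lambda>_. 0)" "laplacian (hform k d) = (\<lambda>_. 0)"
  shows "(\<Prod>i<k. of_nat (CARD('n) + 2 * i)) * sphere_mean (\<lambda>x. hform k c x * hform k d x)
       = fischer_form k c d"
  using assms
proof (induction k arbitrary: c d)
  case 0
  have "{\<alpha> :: nat ^ 'n. mdeg \<alpha> = 0} = {0}"
    by (auto simp: mdeg_def vec_eq_iff)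
  thus ?case
    by (simp add: hform_def fischer_form_def mpow_def mfact_def sphere_mean_const)
next
  case (Suc k)
  let ?D = "\<lambda>i c \<alpha>. of_nat (\<alpha> $ i + 1) * c (\<alpha> + axis i 1) :: complex"
  let ?P = "\<Prod>i<k. of_nat (CARD('n) + 2 * i) :: complex"
  let ?M = "sphere_mean (\<lambda>x. hform (Suc k) c x * hform (Suc k) d x)"
  have IH: "?P * sphere_mean (\<lambda>x. hform k (?D i c) x * hform k (?D i d) x)
      = fischer_form k (?D i c) (?D i d)" for i
    using laplacian_partial_deriv_eq_0[OF hpolyfun_hform Suc.prems(1), of i]
      laplacian_partial_deriv_eq_0[OF hpolyfun_hform Suc.prems(2), of i]
    by (intro Suc.IH) (simp_all only: partial_deriv_hform)
  have "of_nat (Suc k + Suc k) * (of_nat CARD('n) + of_nat (Suc k + Suc k) - 2) * ?M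
      = 2 * (\<Sum>i\<in>UNIV. sphere_mean (\<lambda>x. hform k (?D i c) x * hform k (?D i d) x))"
    using sphere_mean_harmonic_mult[OF hpolyfun_hform Suc.prems(1) hpolyfun_hform Suc.prems(2)]
    by (simp only: partial_deriv_hform)
  hence "?P * (of_nat (Suc k + Suc k) * (of_nat CARD('n) + of_nat (Suc k + Suc k) - 2) * ?M)
      = 2 * (\<Sum>i\<in>UNIV. fischer_form k (?D i c) (?D i d))"
    by (simp only: IH[symmetric] sum_distrib_left mult.left_commute[of ?P])
  also have "\<dots> = 2 * (of_nat (Suc k) * fischer_form (Suc k) c d)"
    by (simp only: fischer_form_derivatives)
  \<comment> \<open>Here \<open>(2k + 2) (n + 2k) = 2 (k + 1) (n + 2k)\<close> supplies the new factor of the product.\<close>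
  also have "?P * (of_nat (Suc k + Suc k) * (of_nat CARD('n) + of_nat (Suc k + Suc k) - 2) * ?M)
      = 2 * of_nat (Suc k) * ((\<Prod>i<Suc k. of_nat (CARD('n) + 2 * i)) * ?M)"
    by (simp add: algebra_simps)
  finally show ?case
    by (simp only: mult.assoc mult_cancel_left of_nat_eq_0_iff) simp
qed

text \<open>
  The conjugate of a polynomial is not holomorphic in general, but on real points it agrees with the
  polynomial \<open>cnj (f (vec_cnj x))\<close>, whose coefficients are conjugated.
\<close>

definition vec_cnj :: "complex ^ 'n \<Rightarrow> complex ^ 'n" where
  "vec_cnj x = (\<chi> i. cnj (x $ i))"

lemma hform_cnj: "hform k (\<lambda>\<alpha>. cnj (c \<alpha>)) x = cnj (hform k c (vec_cnj x))"
  by (simp add: hform_def mpow_def vec_cnj_def)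

lemma partial_deriv_cnj:
  assumes "hpolyfun d f"
  shows "partial_deriv i (\<lambda>x. cnj (f (vec_cnj x))) x = cnj (partial_deriv i f (vec_cnj x))"
proof -
  have "((\<lambda>t. f (vec_cnj x + axis i t)) has_field_derivative partial_deriv i f (vec_cnj x)) (at (cnj 0))"
    using has_field_derivative_along_axis[OF hpolyfun_has_derivative[OF assms]] by simp
  from has_field_derivative_cnj_cnj[OF this]
  have "((\<lambda>t. cnj (f (vec_cnj x + axis i (cnj t)))) has_field_derivative
           cnj (partial_deriv i f (vec_cnj x))) (at 0)"
    by (simp add: o_def)
  moreover have "vec_cnj x + axis i (cnj t) = vec_cnj (x + axis i t)" for t
    by (simp add: vec_cnj_def vec_eq_iff axis_def)
  ultimately show ?thesis
    unfolding partial_deriv_def[of _ "\<lambda>x. cnj (f (vec_cnj x))"]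
    by (simp add: DERIV_imp_deriv)
qed

lemma laplacian_hform_cnj:
  assumes "laplacian (hform k c) = (\<lambda>_. 0)"
  shows "laplacian (hform k (\<lambda>\<alpha>. cnj (c \<alpha>))) = (\<lambda>_. 0)"
proof -
  have pd: "partial_deriv i (\<lambda>x. cnj (f (vec_cnj x))) = (\<lambda>x. cnj (partial_deriv i f (vec_cnj x)))"
    if "hpolyfun d f" for d i and f :: "complex ^ 'a \<Rightarrow> complex"
    using partial_deriv_cnj[OF that] by auto
  have "laplacian (hform k (\<lambda>\<alpha>. cnj (c \<alpha>))) = (\<lambda>x. cnj (laplacian (hform k c) (vec_cnj x)))"
    unfolding laplacian_def hform_cnj[abs_def]
    by (simp add: pd[OF hpolyfun_hform] pd[OF hpolyfun_partial_deriv[OF hpolyfun_hform]])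
  thus ?thesis by (simp add: assms)
qed

section \<open>Multinomial expansion and the Fischer inner product\<close>

text \<open>
  Multiplying a term of degree \<open>k\<close> by \<open>y\<^sub>i\<close> yields the term at the shifted index, weighted by its
  \<open>i\<close>-th entry. After the shift these weights add up over \<open>i\<close> to the degree \<open>k + 1\<close>.
\<close>

lemma multinomial_mpow:
  fixes y :: "complex ^ 'n::finite"
  shows "(\<Sum>i\<in>UNIV. y $ i) ^ k = (\<Sum>\<beta> | mdeg \<beta> = k. fact k / of_nat (mfact \<beta>) * mpow y \<beta>)"
proof (induction k)
  case 0
  have "{\<alpha> :: nat ^ 'n. mdeg \<alpha> = 0} = {0}"
    by (auto simp: mdeg_def vec_eq_iff)
  thus ?case by (simp add: mpow_def mfact_def)
next
  case (Suc k)
  let ?F = "\<lambda>\<beta>. fact k / of_nat (mfact \<beta>) * mpow y \<beta>"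
  have mfact_nz: "mfact \<alpha> \<noteq> 0" for \<alpha> :: "nat ^ 'n" by (simp add: mfact_def)
  have "(\<Sum>i\<in>UNIV. y $ i) ^ Suc k = (\<Sum>i\<in>UNIV. \<Sum>\<alpha> | mdeg \<alpha> = k. y $ i * ?F \<alpha>)"
    by (simp only: power_Suc Suc.IH sum_product)
  also have "\<dots> = (\<Sum>i\<in>UNIV. \<Sum>\<alpha> | mdeg \<alpha> = k. of_nat (\<alpha> $ i + 1) * ?F (\<alpha> + axis i 1))"
  proof (intro sum.cong refl)
    fix i :: 'n and \<alpha> :: "nat ^ 'n"
    have "of_nat (\<alpha> $ i + 1) \<noteq> (0 :: complex)" by (simp only: of_nat_eq_0_iff)
    thus "y $ i * ?F \<alpha> = of_nat (\<alpha> $ i + 1) * ?F (\<alpha> + axis i 1)"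
      using mfact_nz[of \<alpha>]
      by (simp only: mfact_add_axis mpow_add_axis of_nat_mult)
         (simp add: field_simps del: of_nat_add of_nat_Suc)
  qed
  also have "\<dots> = (\<Sum>\<beta> | mdeg \<beta> = Suc k. of_nat (mdeg \<beta>) * ?F \<beta>)"
    unfolding sum_mdeg_shift[where F = ?F]
    by (subst sum.swap) (intro sum.cong refl, simp only: mdeg_def of_nat_sum sum_distrib_right)
  also have "\<dots> = (\<Sum>\<beta> | mdeg \<beta> = Suc k. fact (Suc k) / of_nat (mfact \<beta>) * mpow y \<beta>)"
    by (intro sum.cong) (auto simp: field_simps)
  finally show ?case .
qed

lemma mpow_add: "mpow x (\<alpha> + \<beta>) = mpow x \<alpha> * mpow x \<beta>"
  by (simp add: mpow_def power_add prod.distrib)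

lemma csq_power: "csq x ^ k = (\<Sum>\<beta> | mdeg \<beta> = k. fact k / of_nat (mfact \<beta>) * mpow x (2 *s \<beta>))"
  using multinomial_mpow[of "\<chi> i. (x $ i)\<^sup>2" k]
  by (simp add: csq_def mpow_def power_mult)

text \<open>
  The exponents \<open>e t\<close> may coincide, so like terms are collected.
\<close>

lemma has_mcoeffs_sum_mpow:
  assumes T: "finite T" and P: "\<And>x. P x = (\<Sum>t\<in>T. w t * mpow x (e t))"
  shows "has_mcoeffs P (\<lambda>\<gamma>. \<Sum>t | t \<in> T \<and> e t = \<gamma>. w t)"
proof -
  let ?c = "\<lambda>\<gamma>. \<Sum>t | t \<in> T \<and> e t = \<gamma>. w t"
  have sub: "{\<gamma>. ?c \<gamma> \<noteq> 0} \<subseteq> e ` T"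
  proof
    fix \<gamma> assume "\<gamma> \<in> {\<gamma>. ?c \<gamma> \<noteq> 0}"
    hence "{t. t \<in> T \<and> e t = \<gamma>} \<noteq> {}" by (metis (mono_tags) mem_Collect_eq sum.empty)
    thus "\<gamma> \<in> e ` T" by auto
  qed
  have "P x = (\<Sum>\<gamma> | ?c \<gamma> \<noteq> 0. ?c \<gamma> * mpow x \<gamma>)" for x
  proof -
    have "P x = (\<Sum>\<gamma>\<in>e ` T. \<Sum>t | t \<in> T \<and> e t = \<gamma>. w t * mpow x (e t))"
      unfolding P using T by (intro sum.group[symmetric]) auto
    also have "\<dots> = (\<Sum>\<gamma>\<in>e ` T. ?c \<gamma> * mpow x \<gamma>)"
      unfolding sum_distrib_right by (intro sum.cong) auto
    also have "\<dots> = (\<Sum>\<gamma> | ?c \<gamma> \<noteq> 0. ?c \<gamma> * mpow x \<gamma>)"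
      using T sub by (intro sum.mono_neutral_right) auto
    finally show ?thesis .
  qed
  moreover have "finite {\<gamma>. ?c \<gamma> \<noteq> 0}"
    using T by (intro finite_subset[OF sub]) simp
  ultimately show ?thesis by (simp only: has_mcoeffs_def) simp
qed

lemma fischer_inner_sum_mpow:
  assumes T: "finite T" and P: "\<And>x. P x = (\<Sum>t\<in>T. w t * mpow x (e t))"
    and S: "finite S" and Q: "\<And>x. Q x = (\<Sum>s\<in>S. z s * mpow x (e' s))"
  shows "fischer_inner P Q
       = (\<Sum>t\<in>T. \<Sum>s\<in>S. if e t = e' s then of_nat (mfact (e t)) * w t * cnj (z s) else 0)"
proof -
  define c where "c = (\<lambda>\<gamma>. \<Sum>t | t \<in> T \<and> e t = \<gamma>. w t)"
  define d where "d = (\<lambda>\<gamma>. \<Sum>s | s \<in> S \<and> e' s = \<gamma>. z s)"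
  have c: "has_mcoeffs P c" unfolding c_def by (rule has_mcoeffs_sum_mpow[OF T P])
  have d: "has_mcoeffs Q d" unfolding d_def by (rule has_mcoeffs_sum_mpow[OF S Q])
  have c0: "c \<gamma> = 0" if "\<gamma> \<notin> e ` T" for \<gamma>
    unfolding c_def using that by (intro sum.neutral) auto
  have "fischer_inner P Q = (\<Sum>\<gamma> | c \<gamma> \<noteq> 0 \<and> d \<gamma> \<noteq> 0. of_nat (mfact \<gamma>) * c \<gamma> * cnj (d \<gamma>))"
    by (simp add: fischer_inner_def mcoeff_eqI[OF c] mcoeff_eqI[OF d])
  also have "\<dots> = (\<Sum>\<gamma>\<in>e ` T. of_nat (mfact \<gamma>) * c \<gamma> * cnj (d \<gamma>))"
    using T c0 by (intro sum.mono_neutral_left) auto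
  also have "\<dots> = (\<Sum>\<gamma>\<in>e ` T. \<Sum>t | t \<in> T \<and> e t = \<gamma>. of_nat (mfact (e t)) * w t * cnj (d (e t)))"
    by (intro sum.cong refl) (simp add: c_def sum_distrib_left sum_distrib_right)
  also have "\<dots> = (\<Sum>t\<in>T. of_nat (mfact (e t)) * w t * cnj (d (e t)))"
    using T by (intro sum.group) auto
  also have "\<dots> = (\<Sum>t\<in>T. \<Sum>s\<in>S. if e t = e' s then of_nat (mfact (e t)) * w t * cnj (z s) else 0)"
    using S by (intro sum.cong refl)
      (simp add: d_def sum_distrib_left sum.If_cases Int_def conj_commute eq_commute)
  finally show ?thesis .
qed

text \<open>
  Expanding the powers of \<open>|x|\<^sup>2\<close> by the multinomial theorem writes both functions as sums of
  monomials indexed by triples \<open>(j, \<beta>, \<alpha>)\<close>; the Fischer inner product then pairs exactly the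
  triples with equal exponents.
\<close>

lemma fischer_inner_almansi:
  fixes p m :: nat and a b :: "nat \<Rightarrow> nat ^ 'n::finite \<Rightarrow> complex"
  assumes u: "\<And>x. u x = (\<Sum>j<p. (\<Sum>\<alpha> | mdeg \<alpha> + 2 * j = m. a j \<alpha> * mpow x \<alpha>) * csq x ^ j)"
    and v: "\<And>x. v x = (\<Sum>j<p. (\<Sum>\<alpha> | mdeg \<alpha> + 2 * j = m. b j \<alpha> * mpow x \<alpha>) * csq x ^ j)"
  shows "fischer_inner u v =
           (\<Sum>j<p. \<Sum>k<p. \<Sum>\<beta> | mdeg \<beta> = j. \<Sum>\<beta>' | mdeg \<beta>' = k.
              \<Sum>(\<alpha>, \<alpha>') | mdeg \<alpha> + 2 * j = m \<and> mdeg \<alpha>' + 2 * k = m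
                           \<and> \<alpha> + 2 *s \<beta> = \<alpha>' + 2 *s \<beta>'.
                of_nat (mfact (\<alpha> + 2 *s \<beta>)) *
                (fact j / of_nat (mfact \<beta>)) * (fact k / of_nat (mfact \<beta>')) *
                a j \<alpha> * cnj (b k \<alpha>'))"
proof -
  define A where "A j = {\<alpha> :: nat ^ 'n. mdeg \<alpha> + 2 * j = m}" for j
  define B where "B j = {\<beta> :: nat ^ 'n. mdeg \<beta> = j}" for j
  define T where "T = (SIGMA j:{..<p}. B j \<times> A j)"
  define e where "e = (\<lambda>(j :: nat, \<beta>, \<alpha>). \<alpha> + 2 *s \<beta> :: nat ^ 'n)"
  define w where "w c = (\<lambda>(j, \<beta> :: nat ^ 'n, \<alpha>). fact j / of_nat (mfact \<beta>) * c j \<alpha> :: complex)"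
    for c :: "nat \<Rightarrow> nat ^ 'n \<Rightarrow> complex"
  have fA: "finite (A j)" and fB: "finite (B j)" for j
    unfolding A_def B_def by (rule finite_subset[OF _ finite_mdeg_le[of m]], auto) (rule finite_mdeg_eq)
  have fT: "finite T" using fA fB by (auto simp: T_def)
  have sumT: "(\<Sum>t\<in>T. F t) = (\<Sum>j<p. \<Sum>\<beta>\<in>B j. \<Sum>\<alpha>\<in>A j. F (j, \<beta>, \<alpha>))"
    for F :: "_ \<Rightarrow> complex"
  proof -
    have "(\<Sum>j<p. \<Sum>\<beta>\<in>B j. \<Sum>\<alpha>\<in>A j. F (j, \<beta>, \<alpha>)) = (\<Sum>j<p. \<Sum>q\<in>B j \<times> A j. F (j, q))"
      by (intro sum.cong refl) (simp add: sum.cartesian_product case_prod_unfold)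
    also have "\<dots> = (\<Sum>t\<in>T. F t)"
      unfolding T_def using fA fB by (subst sum.Sigma) auto
    finally show ?thesis ..
  qed
  have expand: "(\<Sum>j<p. (\<Sum>\<alpha> | mdeg \<alpha> + 2 * j = m. c j \<alpha> * mpow x \<alpha>) * csq x ^ j)
      = (\<Sum>t\<in>T. w c t * mpow x (e t))" for c x
    unfolding sumT csq_power A_def[symmetric] B_def[symmetric]
    by (simp add: sum_distrib_left sum_distrib_right sum_divide_distrib w_def e_def mpow_add mult_ac)
  let ?t = "\<lambda>j k \<beta> \<beta>' \<alpha> \<alpha>'. of_nat (mfact (\<alpha> + 2 *s \<beta>)) *
                (fact j / of_nat (mfact \<beta>)) * (fact k / of_nat (mfact \<beta>')) * a j \<alpha> * cnj (b k \<alpha>')"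
  have "fischer_inner u v = (\<Sum>t\<in>T. \<Sum>s\<in>T.
          if e t = e s then of_nat (mfact (e t)) * w a t * cnj (w b s) else 0)"
    by (rule fischer_inner_sum_mpow[OF fT _ fT]) (simp_all only: u v expand)
  also have "\<dots> = (\<Sum>j<p. \<Sum>\<beta>\<in>B j. \<Sum>\<alpha>\<in>A j. \<Sum>k<p. \<Sum>\<beta>'\<in>B k. \<Sum>\<alpha>'\<in>A k.
      if \<alpha> + 2 *s \<beta> = \<alpha>' + 2 *s \<beta>' then ?t j k \<beta> \<beta>' \<alpha> \<alpha>' else 0)"
    unfolding sumT by (intro sum.cong refl) (simp add: e_def w_def)
  also have "\<dots> = (\<Sum>j<p. \<Sum>k<p. \<Sum>\<beta>\<in>B j. \<Sum>\<beta>'\<in>B k. \<Sum>\<alpha>\<in>A j. \<Sum>\<alpha>'\<in>A k.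
      if \<alpha> + 2 *s \<beta> = \<alpha>' + 2 *s \<beta>' then ?t j k \<beta> \<beta>' \<alpha> \<alpha>' else 0)"
    by (simp only: sum.swap[of _ "{..<p}" "A _"] sum.swap[of _ "{..<p}" "B _"]
          sum.swap[of _ "B _" "A _"])
  also have "\<dots> = (\<Sum>j<p. \<Sum>k<p. \<Sum>\<beta>\<in>B j. \<Sum>\<beta>'\<in>B k.
      \<Sum>(\<alpha>, \<alpha>') | mdeg \<alpha> + 2 * j = m \<and> mdeg \<alpha>' + 2 * k = m \<and> \<alpha> + 2 *s \<beta> = \<alpha>' + 2 *s \<beta>'.
        ?t j k \<beta> \<beta>' \<alpha> \<alpha>')"
  proof (intro sum.cong refl)
    fix j k \<beta> \<beta>'
    have "(\<Sum>\<alpha>\<in>A j. \<Sum>\<alpha>'\<in>A k. if \<alpha> + 2 *s \<beta> = \<alpha>' + 2 *s \<beta>' then ?t j k \<beta> \<beta>' \<alpha> \<alpha>' else 0)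
        = (\<Sum>(\<alpha>, \<alpha>')\<in>A j \<times> A k. if \<alpha> + 2 *s \<beta> = \<alpha>' + 2 *s \<beta>' then ?t j k \<beta> \<beta>' \<alpha> \<alpha>' else 0)"
      by (simp add: sum.cartesian_product)
    also have "\<dots> = (\<Sum>(\<alpha>, \<alpha>') | mdeg \<alpha> + 2 * j = m \<and> mdeg \<alpha>' + 2 * k = m
        \<and> \<alpha> + 2 *s \<beta> = \<alpha>' + 2 *s \<beta>'. ?t j k \<beta> \<beta>' \<alpha> \<alpha>')"
      using fA by (intro sum.mono_neutral_cong_right) (auto simp: A_def split: if_splits)
    finally show "(\<Sum>\<alpha>\<in>A j. \<Sum>\<alpha>'\<in>A k. if \<alpha> + 2 *s \<beta> = \<alpha>' + 2 *s \<beta>' then ?t j k \<beta> \<beta>' \<alpha> \<alpha>' else 0) = \<dots>" .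
  qed
  finally show ?thesis unfolding B_def .
qed

section \<open>The integral inner product of Almansi expansions\<close>

text \<open>
  Both functions have the same degree \<open>m\<close>, so the rotations by \<open>e\<^bsup>j\<pi>\<i>/p\<^esup>\<close> contribute the factor
  \<open>|e\<^bsup>j\<pi>\<i>/p\<^esup>|\<^sup>2\<^sup>m = 1\<close> and all \<open>p\<close> spheres give the same integral.
\<close>

lemma sphere_inner_homogeneous:
  assumes "p \<ge> 1" and u: "hpolyfun m u" and v: "hpolyfun m v"
  shows "sphere_inner p u v = sphere_mean (\<lambda>x. u x * cnj (v (vec_cnj x)))"
proof -
  have "(\<Sum>j<p. u (exp (of_nat j * of_real pi * \<i> / of_nat p) *s cvec \<zeta>)
           * cnj (v (exp (of_nat j * of_real pi * \<i> / of_nat p) *s cvec \<zeta>)))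
       = of_nat p * (u (cvec \<zeta>) * cnj (v (vec_cnj (cvec \<zeta>))))" for \<zeta>
  proof -
    have "u (exp (of_nat j * of_real pi * \<i> / of_nat p) *s cvec \<zeta>)
           * cnj (v (exp (of_nat j * of_real pi * \<i> / of_nat p) *s cvec \<zeta>))
         = u (cvec \<zeta>) * cnj (v (vec_cnj (cvec \<zeta>)))" for j
    proof -
      define t where "t = exp (of_nat j * of_real pi * \<i> / of_nat p)"
      have "t = cis (real j * pi / real p)"
        by (simp add: t_def cis_conv_exp mult_ac)
      hence "t * cnj t = 1" by (simp add: cis_cnj cis_mult)
      hence "t ^ m * cnj (t ^ m) = 1" by (simp flip: power_mult_distrib)
      moreover have "vec_cnj (cvec \<zeta>) = cvec \<zeta>" by (simp add: vec_cnj_def cvec_def)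
      ultimately have "u (t *s cvec \<zeta>) * cnj (v (t *s cvec \<zeta>)) = u (cvec \<zeta>) * cnj (v (vec_cnj (cvec \<zeta>)))"
        by (simp add: hpolyfun_homogeneous[OF u] hpolyfun_homogeneous[OF v] mult_ac
              flip: mult.assoc[of "t ^ m" "cnj t ^ m"])
      thus ?thesis by (simp only: t_def)
    qed
    thus ?thesis by simp
  qed
  hence "sphere_inner p u v
      = 1 / of_nat p * sphere_mean (\<lambda>x. of_nat p * (u x * cnj (v (vec_cnj x))))"
    by (simp add: sphere_inner_def sphere_mean_def)
  thus ?thesis using assms(1) by (simp add: sphere_mean_cmult)
qed

text \<open>
  On the sphere \<open>|x|\<^sup>2 = 1\<close>, so \<open>u\<close> and \<open>v\<close> agree there with the sums of their harmonic
  components. Components of different degree are orthogonal, and on each diagonal term the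
  integral is the Fischer pairing divided by \<open>n (n + 2) \<dots> (n + 2k - 2)\<close>.
\<close>

lemma sphere_inner_almansi:
  fixes p m :: nat and a b :: "nat \<Rightarrow> nat ^ 'n::finite \<Rightarrow> complex"
  assumes card: "CARD('n) \<ge> 2" and "p \<ge> 1"
    and u: "hpolyfun m u" "\<And>x. u x = (\<Sum>j<p. U j x * csq x ^ j)"
    and v: "hpolyfun m v" "\<And>x. v x = (\<Sum>j<p. V j x * csq x ^ j)"
    and U: "\<And>j x. j < p \<Longrightarrow> U j x = (\<Sum>\<alpha> | mdeg \<alpha> + 2 * j = m. a j \<alpha> * mpow x \<alpha>)"
    and V: "\<And>j x. j < p \<Longrightarrow> V j x = (\<Sum>\<alpha> | mdeg \<alpha> + 2 * j = m. b j \<alpha> * mpow x \<alpha>)"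
    and hU: "\<And>j. j < p \<Longrightarrow> 2 * j \<le> m \<Longrightarrow> U j \<in> harmonic (m - 2 * j)"
    and hV: "\<And>j. j < p \<Longrightarrow> 2 * j \<le> m \<Longrightarrow> V j \<in> harmonic (m - 2 * j)"
  shows "sphere_inner p u v =
           (\<Sum>j<p. \<Sum>\<alpha> | mdeg \<alpha> + 2 * j = m. a j \<alpha> * cnj (b j \<alpha>) *
              (of_nat (mfact \<alpha>) / (\<Prod>i<m - 2 * j. of_nat (CARD('n) + 2 * i))))"
proof -
  let ?V = "\<lambda>j x. cnj (V j (vec_cnj x))"
  let ?R = "\<lambda>j. \<Sum>\<alpha> | mdeg \<alpha> + 2 * j = m. a j \<alpha> * cnj (b j \<alpha>) *
              (of_nat (mfact \<alpha>) / (\<Prod>i<m - 2 * j. of_nat (CARD('n) + 2 * i)))"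
  have index: "{\<alpha> :: nat ^ 'n. mdeg \<alpha> + 2 * j = m} = {\<alpha>. mdeg \<alpha> = m - 2 * j}" if "2 * j \<le> m" for j
    using that by auto
  have empty: "{\<alpha> :: nat ^ 'n. mdeg \<alpha> + 2 * j = m} = {}" if "\<not> 2 * j \<le> m" for j
    using that by auto
  have Uf: "U j = hform (m - 2 * j) (a j)" if "j < p" "2 * j \<le> m" for j
    using U[OF that(1)] by (auto simp: hform_def index[OF that(2)])
  have Vf: "V j = hform (m - 2 * j) (b j)" if "j < p" "2 * j \<le> m" for j
    using V[OF that(1)] by (auto simp: hform_def index[OF that(2)])
  have Vc: "?V j = hform (m - 2 * j) (\<lambda>\<alpha>. cnj (b j \<alpha>))" if "j < p" "2 * j \<le> m" for j
    by (auto simp: hform_cnj Vf[OF that])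
  have UL: "laplacian (hform (m - 2 * j) (a j)) = (\<lambda>_. 0)" if "j < p" "2 * j \<le> m" for j
    using hU[OF that] by (auto simp: polyharmonic_def Uf[OF that])
  have VL: "laplacian (hform (m - 2 * j) (\<lambda>\<alpha>. cnj (b j \<alpha>))) = (\<lambda>_. 0)" if "j < p" "2 * j \<le> m" for j
    using hV[OF that] by (intro laplacian_hform_cnj) (auto simp: polyharmonic_def Vf[OF that])
  \<comment> \<open>For \<open>2 j > m\<close> there is no index \<open>\<alpha>\<close>, and the truncated degree \<open>m - 2 j = 0\<close> is harmless because the component is zero.\<close>
  have U0: "U j = (\<lambda>_. 0)" and V0: "?V j = (\<lambda>_. 0)" if "j < p" "\<not> 2 * j \<le> m" for j
    using U[OF that(1)] V[OF that(1)] by (auto simp: empty[OF that(2)])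
  have UP: "hpolyfun (m - 2 * j) (U j)" and VP: "hpolyfun (m - 2 * j) (?V j)" if "j < p" for j
    using Uf[OF that] U0[OF that] Vc[OF that] V0[OF that]
    by (cases "2 * j \<le> m"; simp add: hpolyfun_hform hpolyfun_zero)+
  have UV: "sphere_mean (\<lambda>x. U j x * ?V k x) =
      (if k = j then ?R j else 0)"
    if "j < p" "k < p" for j k
  proof (cases "2 * j \<le> m \<and> 2 * k \<le> m")
    case False
    hence "U j = (\<lambda>_. 0) \<or> ?V k = (\<lambda>_. 0)" using that U0 V0 by blast
    hence "(\<lambda>x. U j x * ?V k x) = (\<lambda>_. 0)" by (auto simp: fun_eq_iff)
    thus ?thesis using False by (auto simp: sphere_mean_const empty)
  next
    case True
    show ?thesis
    proof (cases "k = j")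
      case False
      have "sphere_mean (\<lambda>x. U j x * ?V k x) = 0"
        unfolding Uf[OF that(1) conjunct1[OF True]] Vc[OF that(2) conjunct2[OF True]] fun_cong[OF Vc[OF that(2) conjunct2[OF True]]]
        by (rule sphere_mean_harmonic_orthogonal[OF card _ hpolyfun_hform UL hpolyfun_hform VL])
           (use that True False in auto)
      thus ?thesis using False by simp
    next
      case jk: True
      let ?P = "\<Prod>i<m - 2 * j. of_nat (CARD('n) + 2 * i) :: complex"
      have "?P * sphere_mean (\<lambda>x. hform (m - 2 * j) (a j) x * hform (m - 2 * j) (\<lambda>\<alpha>. cnj (b j \<alpha>)) x)
          = fischer_form (m - 2 * j) (a j) (\<lambda>\<alpha>. cnj (b j \<alpha>))"
        using True that by (intro sphere_mean_harmonic_eq_fischer UL VL) auto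
      moreover have "?P \<noteq> 0"
        by (auto simp del: of_nat_add)
      ultimately have "sphere_mean (\<lambda>x. U j x * ?V j x)
          = fischer_form (m - 2 * j) (a j) (\<lambda>\<alpha>. cnj (b j \<alpha>)) / ?P"
        unfolding Uf[OF that(1) conjunct1[OF True]] fun_cong[OF Vc[OF that(1) conjunct1[OF True]]]
        by (simp add: field_simps)
      thus ?thesis
        unfolding jk fischer_form_def index[OF conjunct1[OF True]]
        by (simp add: sum_divide_distrib mult_ac)
    qed
  qed
  have "sphere_inner p u v = sphere_mean (\<lambda>x. u x * cnj (v (vec_cnj x)))"
    by (rule sphere_inner_homogeneous[OF assms(2) u(1) v(1)])
  also have "\<dots> = sphere_mean (\<lambda>x. \<Sum>t\<in>{..<p} \<times> {..<p}. U (fst t) x * ?V (snd t) x)"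
  proof (rule sphere_mean_cong)
    fix \<zeta> :: "real ^ 'n" assume "norm \<zeta> = 1"
    hence "csq (cvec \<zeta>) = 1" by (simp add: csq_cvec)
    moreover have "vec_cnj (cvec \<zeta>) = cvec \<zeta>" by (simp add: vec_cnj_def cvec_def)
    ultimately show "u (cvec \<zeta>) * cnj (v (vec_cnj (cvec \<zeta>)))
        = (\<Sum>t\<in>{..<p} \<times> {..<p}. U (fst t) (cvec \<zeta>) * ?V (snd t) (cvec \<zeta>))"
      by (simp add: u(2) v(2) sum_product sum.cartesian_product case_prod_unfold)
  qed
  also have "\<dots> = (\<Sum>t\<in>{..<p} \<times> {..<p}. sphere_mean (\<lambda>x. U (fst t) x * ?V (snd t) x))"
    by (rule sphere_mean_sum[where d = "\<lambda>t. (m - 2 * fst t) + (m - 2 * snd t)"])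
       (auto intro!: hpolyfun_mult UP VP)
  also have "\<dots> = (\<Sum>j<p. \<Sum>k<p. sphere_mean (\<lambda>x. U j x * ?V k x))"
    by (simp add: sum.cartesian_product case_prod_unfold)
  also have "\<dots> = (\<Sum>j<p. \<Sum>k<p. if k = j then ?R j else 0)"
    by (intro sum.cong refl UV) simp_all
  finally show ?thesis by simp
qed

theorem theorem5:
  fixes p m :: nat
    and u v :: "complex ^ 'n::finite \<Rightarrow> complex"
    and U V :: "nat \<Rightarrow> complex ^ 'n \<Rightarrow> complex"
    and a b :: "nat \<Rightarrow> nat ^ 'n \<Rightarrow> complex"
  assumes "CARD('n) \<ge> 2" and "p \<ge> 1"
    and "u \<in> polyharmonic p m" and "v \<in> polyharmonic p m"
    and "\<And>x. u x = (\<Sum>j<p. U j x * csq x ^ j)"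
    and "\<And>j x. j < p \<Longrightarrow> U j x = (\<Sum>\<alpha> | mdeg \<alpha> + 2 * j = m. a j \<alpha> * mpow x \<alpha>)"
    and "\<And>j. j < p \<Longrightarrow> 2 * j \<le> m \<Longrightarrow> U j \<in> harmonic (m - 2 * j)"
    and "\<And>x. v x = (\<Sum>j<p. V j x * csq x ^ j)"
    and "\<And>j x. j < p \<Longrightarrow> V j x = (\<Sum>\<alpha> | mdeg \<alpha> + 2 * j = m. b j \<alpha> * mpow x \<alpha>)"
    and "\<And>j. j < p \<Longrightarrow> 2 * j \<le> m \<Longrightarrow> V j \<in> harmonic (m - 2 * j)"
  shows "sphere_inner p u v =
           (\<Sum>j<p. \<Sum>\<alpha> | mdeg \<alpha> + 2 * j = m.
              a j \<alpha> * cnj (b j \<alpha>) *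
              (of_nat (mfact \<alpha>) / (\<Prod>i<m - 2 * j. of_nat (CARD('n) + 2 * i))))
       \<and> fischer_inner u v =
           (\<Sum>j<p. \<Sum>k<p. \<Sum>\<beta> | mdeg \<beta> = j. \<Sum>\<beta>' | mdeg \<beta>' = k.
              \<Sum>(\<alpha>, \<alpha>') | mdeg \<alpha> + 2 * j = m \<and> mdeg \<alpha>' + 2 * k = m
                           \<and> \<alpha> + 2 *s \<beta> = \<alpha>' + 2 *s \<beta>'.
                of_nat (mfact (\<alpha> + 2 *s \<beta>)) *
                (fact j / of_nat (mfact \<beta>)) * (fact k / of_nat (mfact \<beta>')) *
                a j \<alpha> * cnj (b k \<alpha>'))"
proof -
  have "hpolyfun m u" "hpolyfun m v"
    using assms(3,4) by (simp_all add: polyharmonic_def hpolyfun_if_homogeneous_poly)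
  note sphere = sphere_inner_almansi[OF assms(1,2) this(1) assms(5) this(2) assms(8,6,9,7,10)]
  have "u x = (\<Sum>j<p. (\<Sum>\<alpha> | mdeg \<alpha> + 2 * j = m. a j \<alpha> * mpow x \<alpha>) * csq x ^ j)"
    "v x = (\<Sum>j<p. (\<Sum>\<alpha> | mdeg \<alpha> + 2 * j = m. b j \<alpha> * mpow x \<alpha>) * csq x ^ j)" for x
    using assms(6,9) by (simp_all add: assms(5,8))
  with sphere show ?thesis
    by (intro conjI fischer_inner_almansi)
qed

end
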